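(* Let $G$ be a finite nilpotent group. (1) If $G$ is a $p$-group ($p$ a prime), then the number of connected components of $\mathcal{P}^*(G)$ is the same as the number of subgroups of $G$ of order $p$. In particular, $\mathcal{P}^*(G)$ is connected if and only if $G$ is a cyclic $p$-group or a generalized quaternion $2$-group. (2) If $G$ is not a $p$-group for any prime $p$ and each Sylow subgroup of $G$ is a cyclic group or a generalized quaternion $2$-group, then $\mathcal{P}^*(G)$ is connected and $\mathrm{diam}(\mathcal{P}^*(G))=2$. (3) If $G$ is not a $p$-group for any prime $p$ and $G$ has a Sylow subgroup which is neither a cyclic group nor a generalized quaternion $2$-group, then $\mathcal{P}^*(G)$ is connected and $\mathrm{diam}(\mathcal{P}^*(G))=4$.
   Context: For a finite group $G$, the proper power graph $\mathcal{P}^*(G)$ is the simple graph with vertex set $G\setminus\{1\}$ in which two distinct vertices are adjacent if and only if one is a power of the other. The diameter $\mathrm{diam}(\Gamma)$ of a connected graph $\Gamma$ is the maximum distance between pairs of vertices; it is $\infty$ if $\Gamma$ is disconnected. *)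

theory Defs
  imports
    "HOL-Algebra.Elementary_Groups"
    "HOL-Computational_Algebra.Primes"
    "Graph_Theory.Graph_Theory"
begin

section \<open>Groups\<close>

text \<open>
  The upper central series: the next term is the preimage of the centre of \<open>G / Z\<^sub>n\<close>,
  i.e. the set of all \<open>x\<close> with \<open>[x, y] \<in> Z\<^sub>n\<close> for every \<open>y\<close>.
\<close>

primrec upper_central_series :: "('a, 'b) monoid_scheme \<Rightarrow> nat \<Rightarrow> 'a set" where
  "upper_central_series G 0 = {\<one>\<^bsub>G\<^esub>}"
| "upper_central_series G (Suc n) =
    {x \<in> carrier G. \<forall>y \<in> carrier G.
       x \<otimes>\<^bsub>G\<^esub> y \<otimes>\<^bsub>G\<^esub> inv\<^bsub>G\<^esub> x \<otimes>\<^bsub>G\<^esub> inv\<^bsub>G\<^esub> y \<in> upper_central_series G n}"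

definition nilpotent_group :: "('a, 'b) monoid_scheme \<Rightarrow> bool" where
  "nilpotent_group G \<longleftrightarrow> group G \<and> (\<exists>n. upper_central_series G n = carrier G)"

text \<open>Finite \<open>p\<close>-groups; the trivial group is a \<open>p\<close>-group for every prime \<open>p\<close>.\<close>

definition p_group :: "nat \<Rightarrow> ('a, 'b) monoid_scheme \<Rightarrow> bool" where
  "p_group p G \<longleftrightarrow> prime p \<and> group G \<and> finite (carrier G) \<and> (\<exists>n. order G = p ^ n)"

definition sylow_subgroup :: "nat \<Rightarrow> 'a set \<Rightarrow> ('a, 'b) monoid_scheme \<Rightarrow> bool" where
  "sylow_subgroup p P G \<longleftrightarrow>
     prime p \<and> subgroup P G \<and> card P = p ^ multiplicity p (order G)"

text \<open>
  The generalized quaternion group of order \<open>2^n\<close>, \<open>n \<ge> 3\<close> (the quaternion group of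
  order 8 is included), is presented by generators \<open>x\<close>, \<open>y\<close> and relations
  \<open>x^(2^(n-1)) = 1\<close>, \<open>y^2 = x^(2^(n-2))\<close>, \<open>y\<inverse> x y = x\<inverse>\<close>.  The presented group
  has order exactly \<open>2^n\<close>, so a group generated by elements satisfying these relations is
  isomorphic to it iff it has order \<open>2^n\<close>.
\<close>

definition generalized_quaternion_2_group :: "('a, 'b) monoid_scheme \<Rightarrow> bool" where
  "generalized_quaternion_2_group G \<longleftrightarrow> group G \<and>
     (\<exists>n\<ge>3. order G = 2 ^ n \<and>
       (\<exists>x \<in> carrier G. \<exists>y \<in> carrier G.
          generate G {x, y} = carrier G \<and>
          x [^]\<^bsub>G\<^esub> (2 ^ (n - 1) :: nat) = \<one>\<^bsub>G\<^esub> \<and>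
          y [^]\<^bsub>G\<^esub> (2 :: nat) = x [^]\<^bsub>G\<^esub> (2 ^ (n - 2) :: nat) \<and>
          inv\<^bsub>G\<^esub> y \<otimes>\<^bsub>G\<^esub> x \<otimes>\<^bsub>G\<^esub> y = inv\<^bsub>G\<^esub> x))"

section \<open>Graphs\<close>

text \<open>
  A simple graph is a digraph satisfying the locale predicate \<^const>\<open>graph\<close>: each edge is
  represented by its two opposite arcs.  For such digraphs \<^const>\<open>pre_digraph.sccs\<close> is
  the set of connected components.
\<close>

text \<open>
  The library's connectedness excludes the empty graph.  Here the empty graph counts as
  connected: the proper power graph of the trivial group, which is a cyclic \<open>p\<close>-group, is
  empty.
\<close>

definition graph_connected :: "('a, 'b) pre_digraph \<Rightarrow> bool" where
  "graph_connected \<Gamma> \<longleftrightarrow> verts \<Gamma> = {} \<or> Digraph_Component.connected \<Gamma>"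

definition graph_dist :: "('a, 'b) pre_digraph \<Rightarrow> 'a \<Rightarrow> 'a \<Rightarrow> ereal" where
  "graph_dist \<Gamma> u v = wf_digraph.\<mu> \<Gamma> (\<lambda>_. 1) u v"

definition graph_diam :: "('a, 'b) pre_digraph \<Rightarrow> ereal" where
  "graph_diam \<Gamma> =
     (if graph_connected \<Gamma> then SUP u \<in> verts \<Gamma>. SUP v \<in> verts \<Gamma>. graph_dist \<Gamma> u v else \<infinity>)"

definition proper_power_graph :: "('a, 'b) monoid_scheme \<Rightarrow> ('a, 'a \<times> 'a) pre_digraph" where
  "proper_power_graph G = with_proj
     \<lparr> pverts = carrier G - {\<one>\<^bsub>G\<^esub>},
       parcs = {(x, y). x \<in> carrier G - {\<one>\<^bsub>G\<^esub>} \<and> y \<in> carrier G - {\<one>\<^bsub>G\<^esub>} \<and> x \<noteq> y \<and>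
                  ((\<exists>k::nat. y = x [^]\<^bsub>G\<^esub> k) \<or> (\<exists>k::nat. x = y [^]\<^bsub>G\<^esub> k))} \<rparr>"

lemma graph_proper_power_graph:
  assumes "finite (carrier G)"
  shows "graph (proper_power_graph G)"
proof -
  let ?V = "carrier G - {\<one>\<^bsub>G\<^esub>}"
  let ?E = "{(x, y). x \<in> ?V \<and> y \<in> ?V \<and> x \<noteq> y \<and>
    ((\<exists>k::nat. y = x [^]\<^bsub>G\<^esub> k) \<or> (\<exists>k::nat. x = y [^]\<^bsub>G\<^esub> k))}"
  have "finite ?E"
    by (rule finite_subset[of _ "?V \<times> ?V"]) (use assms in auto)
  moreover have "sym ?E"
    by (auto intro!: symI)
  ultimately have "pair_graph \<lparr> pverts = ?V, parcs = ?E \<rparr>"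
    using assms by unfold_locales (auto simp: symmetric_def)
  then show ?thesis
    unfolding proper_power_graph_def by (rule pair_graph.pair_graphD_graph)
qed

end

theory Submission
  imports Defs "HOL-Algebra.Sylow" "HOL-Number_Theory.Residues"
begin

text \<open>
  In a cyclic group any two elements of the same prime order generate the same subgroup, so a
  path in the power graph of a \<open>p\<close>-group never changes the subgroup of order \<open>p\<close> below its
  vertices: components correspond to subgroups of order \<open>p\<close>.  When several primes divide the
  order, commuting elements \<open>x\<close>, \<open>y\<close> of coprime orders are joined through \<open>x \<otimes> y\<close>,
  which bounds the distances from above; generators of two distinct subgroups of the
  same prime order are at distance at least 4, as they lie in no common cyclic subgroup.

  A nilpotent \<open>p\<close>-group with a single subgroup of order \<open>p\<close> is cyclic or generalized
  quaternion: let \<open>A = \<langle>a\<rangle>\<close> be a maximal normal cyclic subgroup.  For \<open>b \<notin> A\<close> with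
  \<open>b\<^sup>p \<in> A\<close>, either some element \<open>a\<^sup>i b\<close> has order \<open>p\<close>, which is excluded,
  or \<open>a \<in> \<langle>b\<rangle>\<close>, or \<open>p = 2\<close> and \<open>b\<close> inverts \<open>a\<close> with
  \<open>b\<^sup>2\<close> the involution of \<open>A\<close>.  Maximality makes \<open>A\<close> self-centralizing, which
  leaves only the last case.  As \<open>-1\<close>
  is not a square modulo 4, every element outside \<open>A\<close> inverts \<open>a\<close>, whence the index of
  \<open>A\<close> is at most 2.
\<close>

section \<open>Congruences for cyclic extensions of prime degree\<close>

text \<open>With \<open>r = 1 + p t\<close>, the power \<open>r ^ j\<close> is
  \<open>1 + j p t\<close> modulo \<open>p\<close> squared, so the sum is \<open>p\<close> plus
  \<open>p t\<close> times the sum of all \<open>j\<close> below \<open>p\<close>. The extra term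
  vanishes because \<open>p\<close> divides that triangular number if \<open>p\<close> is odd, and
  because \<open>t\<close> is even if \<open>p = 2\<close>.\<close>

lemma sum_powers_cong_prime:
  fixes p :: nat and r :: int
  assumes "prime p" and "int p dvd r - 1" and "p = 2 \<Longrightarrow> 4 dvd r - 1"
  shows "[(\<Sum>j<p. r ^ j) = int p] (mod (int p)\<^sup>2)"
proof -
  from assms(2) obtain t where "r - 1 = int p * t" by (rule dvdE)
  then have t: "r = 1 + int p * t" by simp
  have pow: "[r ^ j = 1 + int j * (int p * t)] (mod (int p)\<^sup>2)" for j
  proof (induction j)
    case (Suc j)
    have "[r ^ Suc j = (1 + int p * t) * (1 + int j * (int p * t))] (mod (int p)\<^sup>2)"
      using Suc unfolding t by (auto intro: cong_mult)
    moreover have "(1 + int p * t) * (1 + int j * (int p * t)) =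
        1 + int (Suc j) * (int p * t) + (int p)\<^sup>2 * (int j * t * t)"
      by (simp add: algebra_simps power2_eq_square)
    ultimately show ?case
      by (metis cong_add_lcancel_0 cong_mult_self_left cong_trans)
  qed simp
  have "[(\<Sum>j<p. r ^ j) = (\<Sum>j<p. 1 + int j * (int p * t))] (mod (int p)\<^sup>2)"
    by (intro cong_sum pow)
  moreover have "(\<Sum>j<p. 1 + int j * (int p * t)) = int p + (\<Sum>j<p. int j) * (int p * t)"
    by (simp add: sum.distrib sum_distrib_right)
  moreover have "(int p)\<^sup>2 dvd (\<Sum>j<p. int j) * (int p * t)"
  proof (cases "p = 2")
    case True
    then have "2 dvd t" using assms(3) t by auto
    with True show ?thesis by (auto simp: lessThan_nat_numeral)
  next
    case False
    then have odd: "odd p" using assms(1) primes_dvd_imp_eq two_is_prime_nat by blast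
    have "2 * (\<Sum>j<p. int j) = int p * (int p - 1)"
      by (induction p) (auto simp: algebra_simps)
    moreover from odd have "even (int p - 1)" by simp
    then obtain k where "int p - 1 = 2 * k" by (rule dvdE)
    ultimately have "(\<Sum>j<p. int j) = int p * k"
      by simp
    then show ?thesis by (simp add: power2_eq_square)
  qed
  ultimately show ?thesis
    by (metis cong_add_lcancel_0 cong_0_iff cong_trans)
qed

text \<open>\<open>S\<close> is \<open>p\<close> times a unit modulo \<open>p ^ m\<close>, and
  \<open>s\<close> absorbs the factor \<open>p\<close>, so inverting the unit solves the congruence.
  The solution will be the exponent \<open>i\<close> that makes \<open>(a^i b)^p\<close>
  trivial.\<close>

lemma solve_linear_prime_power:
  fixes S :: int and p s m :: nat
  assumes "prime p" "m \<ge> 1" "p dvd s" "[S = int p] (mod (int p)\<^sup>2)"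
  shows "\<exists>i::nat. int p ^ m dvd int i * S + int s"
proof -
  have p0: "p > 0" using assms(1) prime_gt_0_nat by blast
  from assms(4) obtain k where "S - int p = (int p)\<^sup>2 * k"
    by (auto simp: cong_iff_dvd_diff)
  then have S: "S = int p * (1 + int p * k)" by (simp add: algebra_simps power2_eq_square)
  have cop: "coprime (1 + int p * k) (int p ^ m)"
    by (simp add: coprime_iff_gcd_eq_1 gcd.commute) (metis add.commute coprime_commute coprime_iff_gcd_eq_1 coprime_power_right_iff gcd_add_mult gcd_1_int mult.commute)
  obtain s' where s': "s = p * s'" using assms(3) by blast
  from cong_solve_coprime_int[OF cop] obtain x where x: "[(1 + int p * k) * x = 1] (mod int p ^ m)"
    by blast
  \<comment> \<open>Reduction modulo \<open>p ^ m\<close> makes the integer solution nonnegative, as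
    an exponent must be.\<close>
  define i where "i = nat ((- int s' * x) mod int p ^ m)"
  have "[int i = - int s' * x] (mod int p ^ m)"
    using p0 by (simp add: i_def cong_def)
  then have "[int i * S = - int s' * x * S] (mod int p ^ m)"
    by (rule cong_mult) simp
  moreover have "- int s' * x * S = - int s * ((1 + int p * k) * x)"
    by (simp add: S s')
  moreover have "[- int s * ((1 + int p * k) * x) = - int s * 1] (mod int p ^ m)"
    using x by (intro cong_mult) auto
  ultimately have "[int i * S = - int s] (mod int p ^ m)"
    by (metis cong_trans mult.right_neutral)
  then show ?thesis by (auto simp: cong_iff_dvd_diff)
qed

text \<open>\<open>x\<close> is twice an odd number and so accounts for only one factor 2 of the
  product.\<close>

lemma dvd_two_power_half:
  fixes x :: int
  assumes "int 2 ^ m dvd x * y" "4 dvd x - 2" "m \<ge> 1"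
  shows "2 ^ (m - 1) dvd y"
proof -
  from assms(2) obtain k where "x - 2 = 4 * k" by blast
  then have x: "x = 2 * (1 + 2 * k)" by simp
  have "(2::int) ^ m = 2 * 2 ^ (m - 1)" using assms(3) by (cases m) auto
  with assms(1) x have "(2::int) ^ (m - 1) dvd (1 + 2 * k) * y"
    by (metis dvd_mult_cancel_left mult.assoc of_nat_numeral zero_neq_numeral)
  moreover have "coprime ((2::int) ^ (m - 1)) (1 + 2 * k)"
    by simp
  ultimately show ?thesis using coprime_dvd_mult_right_iff by blast
qed

text \<open>\<open>y\<close> is an odd multiple of \<open>2 ^ (m - 1)\<close>, and any two odd
  multiples differ by a multiple of \<open>2 ^ m\<close>.\<close>

lemma two_power_not_dvd:
  fixes y :: int
  assumes "2 ^ (m - 1) dvd y" "\<not> 2 ^ m dvd y" "m \<ge> 1"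
  shows "2 ^ m dvd y - 2 ^ (m - 1)"
proof -
  from assms(1) obtain k where k: "y = 2 ^ (m - 1) * k" by blast
  have m: "(2::int) ^ m = 2 ^ (m - 1) * 2" using assms(3) by (cases m) auto
  with k assms(2) have "odd k" by auto
  then obtain l where "k = 2 * l + 1" by (rule oddE)
  then have "y - 2 ^ (m - 1) = 2 ^ m * l" by (simp add: k m algebra_simps)
  then show ?thesis by simp
qed

text \<open>
  If \<open>a\<close> has order \<open>p\<^sup>m\<close>, \<open>b a b\<inverse> = a\<^sup>r\<close> and \<open>b\<^sup>p = a\<^sup>s\<close>, then
  \<open>(a\<^sup>i b)\<^sup>p\<close> is the power of \<open>a\<close> with exponent
  \<open>i (1 + r + \<dots> + r\<^bsup>p-1\<^esup>) + s\<close>, and the last two hypotheses express that \<open>b\<^sup>p\<close> commutes with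
  \<open>a\<close> and with \<open>b\<close>.
\<close>

lemma prime_power_extension_exponents:
  fixes p r s m :: nat
  assumes p: "prime p" and m: "m \<ge> 1" and s: "p dvd s"
    and r: "int p ^ m dvd int r ^ p - 1" and sr: "int p ^ m dvd int s * (int r - 1)"
  shows "(\<exists>i. p ^ m dvd i * (\<Sum>j<p. r ^ j) + s) \<or>
    (p = 2 \<and> m \<ge> 2 \<and> 2 ^ m dvd r + 1 \<and> int 2 ^ m dvd int s - 2 ^ (m - 1))"
proof -
  have transfer: "p ^ m dvd i * (\<Sum>j<p. r ^ j) + s" if "int p ^ m dvd int i * (\<Sum>j<p. int r ^ j) + int s" for i
    using that by (simp flip: of_nat_power of_nat_mult of_nat_sum of_nat_add)
  have "int p dvd int r ^ p - 1"
    using r m by (meson dvd_power dvd_trans le_numeral_extra(4) less_le_trans zero_less_one)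
  \<comment> \<open>Fermat: \<open>r ^ p\<close> is congruent to \<open>r\<close>, and it is also 1
    modulo \<open>p\<close>, so \<open>r\<close> is 1 modulo \<open>p\<close>.\<close>
  moreover have "[int r ^ p = int r] (mod int p)"
  proof (cases "int p dvd int r")
    case True
    then have "int p dvd int r ^ p"
      using dvd_power[of p "int r"] p prime_gt_0_nat dvd_trans by blast
    with True show ?thesis by (meson cong_0_iff cong_sym cong_trans)
  next
    case False
    then have "[r ^ (p - 1) = 1] (mod p)"
      using p by (intro fermat_theorem) auto
    then have "[r ^ (p - 1) * r = 1 * r] (mod p)" by (rule cong_mult) simp
    moreover have "r ^ (p - 1) * r = r ^ p"
      using p prime_gt_0_nat by (metis mult.commute power_eq_if not_gr_zero)
    ultimately show ?thesis by (metis cong_int_iff mult_1 of_nat_power)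
  qed
  ultimately have r1: "int p dvd int r - 1"
    by (metis cong_iff_dvd_diff cong_sym cong_trans)
  \<comment> \<open>The sum is \<open>p\<close> modulo \<open>p\<close> squared unless
    \<open>p = 2\<close> and \<open>r\<close> is 3 modulo 4.\<close>
  consider "[(\<Sum>j<p. int r ^ j) = int p] (mod (int p)\<^sup>2)" | "p = 2" "\<not> 4 dvd int r - 1"
    using sum_powers_cong_prime[OF p r1] by blast
  then show ?thesis
  proof cases
    case 1
    then show ?thesis using solve_linear_prime_power[OF p m s] transfer by blast
  next
    case 2
    \<comment> \<open>Here \<open>r - 1\<close> is 2 modulo 4, so it takes up a single factor 2 in
      both divisibility hypotheses; \<open>r + 1\<close> and \<open>s\<close> are thus divisible by
      \<open>2 ^ (m - 1)\<close>.\<close>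
    have r3: "4 dvd (int r - 1) - 2" using 2 r1 by presburger
    have r1': "2 ^ (m - 1) dvd int r + 1"
    proof (rule dvd_two_power_half)
      show "int 2 ^ m dvd (int r - 1) * (int r + 1)"
        using r 2 by (simp add: algebra_simps power2_eq_square)
    qed (use r3 m in auto)
    have s1: "2 ^ (m - 1) dvd int s"
      by (rule dvd_two_power_half[where x = "int r - 1"]) (use sr r3 m 2 in \<open>auto simp: mult.commute\<close>)
    have sum2: "(\<Sum>j<p. int r ^ j) = int r + 1" using 2 by (simp add: lessThan_nat_numeral)
    show ?thesis
    proof (cases "2 ^ m dvd int s")
      case True
      then have "p ^ m dvd 0 * (\<Sum>j<p. r ^ j) + s" using 2 by (intro transfer) simp
      then show ?thesis by blast
    next
      case False
      have s2: "2 ^ m dvd int s - 2 ^ (m - 1)" using two_power_not_dvd[OF s1 False m] .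
      have "m \<noteq> 1" using False s 2 by auto
      then have m2: "m \<ge> 2" using m by simp
      show ?thesis
      proof (cases "2 ^ m dvd int r + 1")
        case True
        then have "2 ^ m dvd r + 1"
          by (metis int_dvd_int_iff of_nat_1 of_nat_add of_nat_numeral of_nat_power)
        then show ?thesis using 2 m2 s2 by auto
      next
        \<comment> \<open>Both \<open>r + 1\<close> and \<open>s\<close> are
          \<open>2 ^ (m - 1)\<close> modulo \<open>2 ^ m\<close>, so they cancel and
          \<open>i = 1\<close> solves the congruence.\<close>
        case r2: False
        have "2 ^ m dvd (int r + 1 - 2 ^ (m - 1)) + (int s - 2 ^ (m - 1)) + 2 ^ m"
          by (intro dvd_add s2 two_power_not_dvd[OF r1' r2 m]) simp
        moreover have "(2::int) ^ m = 2 * 2 ^ (m - 1)" using m by (cases m) auto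
        ultimately have "2 ^ m dvd int r + 1 + int s" by (simp add: algebra_simps)
        then have "p ^ m dvd 1 * (\<Sum>j<p. r ^ j) + s" using sum2 2 by (intro transfer) simp
        then show ?thesis by blast
      qed
    qed
  qed
qed

section \<open>Cyclic subgroups and nilpotent groups\<close>

context group
begin

lemma inv_mult_cancel_left:
  "x \<in> carrier G \<Longrightarrow> y \<in> carrier G \<Longrightarrow> inv x \<otimes> (x \<otimes> y) = y"
  "x \<in> carrier G \<Longrightarrow> y \<in> carrier G \<Longrightarrow> x \<otimes> (inv x \<otimes> y) = y"
  by (simp_all flip: m_assoc)

lemmas group_word_simps = m_assoc inv_mult_group inv_mult_cancel_left

lemma commutator_eq_one_iff:
  assumes "x \<in> carrier G" "y \<in> carrier G"
  shows "x \<otimes> y \<otimes> inv x \<otimes> inv y = \<one> \<longleftrightarrow> x \<otimes> y = y \<otimes> x"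
proof -
  have "x \<otimes> y \<otimes> inv x \<otimes> inv y = (x \<otimes> y) \<otimes> inv (y \<otimes> x)"
    using assms by (simp add: inv_mult_group m_assoc)
  moreover have "(x \<otimes> y) \<otimes> inv (y \<otimes> x) = \<one> \<longleftrightarrow> x \<otimes> y = y \<otimes> x"
    using assms inv_solve_right[of \<one> "x \<otimes> y" "y \<otimes> x"] by auto
  ultimately show ?thesis by simp
qed

lemma generate_singleton_mono:
  assumes "b \<in> carrier G" "a \<in> generate G {b}"
  shows "generate G {a} \<subseteq> generate G {b}"
  using assms by (simp add: generate_is_subgroup generate_subgroup_incl)

lemma generate_singleton_in_carrier:
  "a \<in> carrier G \<Longrightarrow> x \<in> generate G {a} \<Longrightarrow> x \<in> carrier G"
  by (rule generate_in_carrier[of "{a}"]) auto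

lemma self_in_generate_singleton: "a \<in> generate G {a}"
  by (simp add: generate.incl)

lemma nat_pow_in_generate_singleton:
  assumes "a \<in> carrier G"
  shows "a [^] (k::nat) \<in> generate G {a}"
proof -
  have "a [^] k = a [^] int k" by (simp add: int_pow_int)
  then show ?thesis unfolding generate_pow[OF assms] by blast
qed

lemma in_generate_singletonE:
  assumes "finite (carrier G)" "a \<in> carrier G" "x \<in> generate G {a}"
  obtains k :: nat where "x = a [^] k"
  using assms generate_pow_on_finite_carrier by blast

lemma nat_pow_eq_iff_cong:
  assumes "x \<in> carrier G"
  shows "x [^] (m::nat) = x [^] (n::nat) \<longleftrightarrow> [m = n] (mod ord x)"
proof -
  have "x [^] m = x [^] n \<longleftrightarrow> int (ord x) dvd int n - int m"
    using int_pow_eq[OF assms, of "int m" "int n"] by (simp add: int_pow_int)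
  also have "\<dots> \<longleftrightarrow> [n = m] (mod ord x)"
    by (simp add: cong_int_iff flip: cong_iff_dvd_diff)
  finally show ?thesis by (simp add: cong_sym_eq)
qed

text \<open>If \<open>x = z^i\<close> has order \<open>p\<close>, then \<open>ord z\<close> divides
  \<open>i p\<close>, so \<open>ord z div p\<close> divides \<open>i\<close>: \<open>x\<close> is a
  power of \<open>w = z^(ord z div p)\<close>, which has order \<open>p\<close> too. Thus
  \<open>x\<close> and \<open>y\<close> both generate the subgroup of \<open>w\<close>.\<close>

lemma prime_order_cyclic_unique:
  assumes fin: "finite (carrier G)" and z: "z \<in> carrier G"
    and x: "x \<in> generate G {z}" "ord x = p" and y: "y \<in> generate G {z}" "ord y = p"
    and p: "prime p"
  shows "x \<in> generate G {y}"
proof -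
  define w where "w = z [^] (ord z div p)"
  have w: "w \<in> carrier G" using z by (simp add: w_def)
  have n0: "ord z \<noteq> 0" using ord_ge_1[OF fin z] by simp
  have gen: "generate G {u} = generate G {w}" if u: "u \<in> generate G {z}" "ord u = p" for u
  proof -
    obtain i :: nat where i: "u = z [^] i" using in_generate_singletonE[OF fin z u(1)] .
    have uc: "u \<in> carrier G" using i z by simp
    have "u [^] p = \<one>" using u(2) uc by (simp add: pow_eq_id)
    then have dvd: "ord z dvd i * p" using i z by (simp add: nat_pow_pow pow_eq_id)
    have "u [^] ord z = \<one>" using i z by (metis nat_pow_pow mult.commute pow_ord_eq_1 nat_pow_one)
    then have pz: "p dvd ord z" using u uc pow_eq_id by blast
    then have "ord z div p dvd i" using dvd p
      by (metis dvd_mult_div_cancel dvd_times_right_cancel_iff mult.commute not_prime_0)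
    then obtain l where "i = (ord z div p) * l" by blast
    then have "u = w [^] l" using i z by (simp add: w_def nat_pow_pow)
    then have sub: "generate G {u} \<subseteq> generate G {w}"
      using nat_pow_in_generate_singleton[OF w] generate_singleton_mono[OF w] by blast
    have "ord w = p"
    proof -
      obtain q where q: "ord z = p * q" using pz by blast
      with p n0 have "ord z div p = q" "q \<noteq> 0" by auto
      then show ?thesis using ord_pow[OF z, of q] q by (simp add: w_def)
    qed
    then have "card (generate G {u}) = card (generate G {w})"
      using u(2) generate_pow_card[OF w] generate_pow_card[OF uc] by simp
    moreover have "finite (generate G {w})"
      using generate_incl[of "{w}"] w fin finite_subset by blast
    ultimately show ?thesis using sub by (simp add: card_subset_eq)
  qed
  show ?thesis using gen[OF x] gen[OF y] self_in_generate_singleton by blast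
qed

text \<open>\<open>c\<close> is the commutator of \<open>x\<close> and \<open>y\<close> and commutes
  with both, so moving \<open>y\<close> past \<open>x^k\<close>, or \<open>x\<close> past
  \<open>y^k\<close>, collects \<open>c^k\<close>. For \<open>k = a\<close> and \<open>k = b\<close>
  this gives \<open>c^a = c^b = \<one>\<close> with coprime exponents.\<close>

lemma trivial_commutator_of_coprime_orders:
  assumes c: "x \<in> carrier G" "y \<in> carrier G" "c \<in> carrier G"
    and xy: "x \<otimes> y = c \<otimes> (y \<otimes> x)" and cx: "c \<otimes> x = x \<otimes> c" and cy: "c \<otimes> y = y \<otimes> c"
    and ord: "x [^] a = \<one>" "y [^] b = \<one>" "coprime a (b::nat)"
  shows "c = \<one>"
proof -
  have "x [^] k \<otimes> y = c [^] k \<otimes> (y \<otimes> x [^] k)" for k :: nat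
  proof (induction k)
    case (Suc k)
    have "x [^] Suc k \<otimes> y = (x [^] k \<otimes> c) \<otimes> (y \<otimes> x)" using c xy by (simp add: m_assoc)
    also have "x [^] k \<otimes> c = c \<otimes> x [^] k" by (rule group_commutes_pow[OF cx[symmetric] c(1,3)])
    also have "(c \<otimes> x [^] k) \<otimes> (y \<otimes> x) = c \<otimes> (x [^] k \<otimes> y) \<otimes> x" using c by (simp add: m_assoc)
    also have "\<dots> = (c \<otimes> c [^] k) \<otimes> (y \<otimes> x [^] Suc k)" unfolding Suc using c by (simp add: m_assoc)
    also have "c \<otimes> c [^] k = c [^] Suc k" by (simp only: nat_pow_Suc2[OF c(3)])
    finally show ?case .
  qed (use c in simp)
  from this[of a] have a: "c [^] a = \<one>" using c ord by simp
  have "x \<otimes> y [^] k = c [^] k \<otimes> (y [^] k \<otimes> x)" for k :: nat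
  proof (induction k)
    case (Suc k)
    have "x \<otimes> y [^] Suc k = (x \<otimes> y [^] k) \<otimes> y" using c by (simp add: m_assoc)
    also have "\<dots> = c [^] k \<otimes> y [^] k \<otimes> (x \<otimes> y)" unfolding Suc using c by (simp add: m_assoc)
    also have "\<dots> = c [^] k \<otimes> (y [^] k \<otimes> c) \<otimes> (y \<otimes> x)" unfolding xy using c by (simp add: m_assoc)
    also have "y [^] k \<otimes> c = c \<otimes> y [^] k" by (rule group_commutes_pow[OF cy[symmetric] c(2,3)])
    also have "c [^] k \<otimes> (c \<otimes> y [^] k) \<otimes> (y \<otimes> x) = c [^] Suc k \<otimes> (y [^] Suc k \<otimes> x)"
      using c by (simp add: m_assoc)
    finally show ?case .
  qed (use c in simp)
  from this[of b] have b: "c [^] b = \<one>" using c ord by simp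
  have "ord c = 1" using a b c ord(3) by (meson coprime_common_divisor_nat pow_eq_id)
  then show ?thesis using c ord_eq_1 by simp
qed

text \<open>The set is the preimage of the centre of \<open>G Mod N\<close>. Each closure property
  rewrites a commutator in terms of conjugates of elements of \<open>N\<close>, for instance
  \<open>[ab, y] = a [b, y] a^-1 [a, y]\<close> and
  \<open>[g a g^-1, y] = g [a, g^-1 y g] g^-1\<close>.\<close>

lemma normal_preimage_of_centre:
  assumes "N \<lhd> G"
  shows "{x \<in> carrier G. \<forall>y \<in> carrier G. x \<otimes> y \<otimes> inv x \<otimes> inv y \<in> N} \<lhd> G" (is "?Z \<lhd> G")
proof -
  interpret N: normal N G by fact
  have conj: "g \<otimes> n \<otimes> inv g \<in> N" if "g \<in> carrier G" "n \<in> N" for g n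
    using N.inv_op_closed2 that by blast
  show ?thesis unfolding normal_inv_iff
  proof (intro conjI ballI subgroupI)
    show "?Z \<noteq> {}"
    proof -
      have "\<one> \<in> ?Z" by (auto simp: m_assoc)
      then show ?thesis by blast
    qed
  next
    fix a assume "a \<in> ?Z"
    then have a: "a \<in> carrier G" "\<And>y. y \<in> carrier G \<Longrightarrow> a \<otimes> y \<otimes> inv a \<otimes> inv y \<in> N" by auto
    have "inv a \<otimes> y \<otimes> inv (inv a) \<otimes> inv y \<in> N" if y: "y \<in> carrier G" for y
    proof -
      have "inv a \<otimes> inv (a \<otimes> y \<otimes> inv a \<otimes> inv y) \<otimes> inv (inv a) \<in> N"
        by (intro conj N.m_inv_closed a(2) y inv_closed a(1))
      then show ?thesis using a(1) y by (simp add: group_word_simps)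
    qed
    then show "inv a \<in> ?Z" using a by simp
  next
    fix a b assume "a \<in> ?Z" "b \<in> ?Z"
    then have a: "a \<in> carrier G" "\<And>y. y \<in> carrier G \<Longrightarrow> a \<otimes> y \<otimes> inv a \<otimes> inv y \<in> N"
      and b: "b \<in> carrier G" "\<And>y. y \<in> carrier G \<Longrightarrow> b \<otimes> y \<otimes> inv b \<otimes> inv y \<in> N" by auto
    have "a \<otimes> b \<otimes> y \<otimes> inv (a \<otimes> b) \<otimes> inv y \<in> N" if y: "y \<in> carrier G" for y
    proof -
      have "(a \<otimes> (b \<otimes> y \<otimes> inv b \<otimes> inv y) \<otimes> inv a) \<otimes> (a \<otimes> y \<otimes> inv a \<otimes> inv y) \<in> N"
        by (intro N.m_closed[OF conj[OF a(1) b(2)[OF y]] a(2)[OF y]])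
      then show ?thesis using a(1) b(1) y by (simp add: group_word_simps)
    qed
    then show "a \<otimes> b \<in> ?Z" using a b by simp
  next
    fix g a assume g: "g \<in> carrier G" and "a \<in> ?Z"
    then have a: "a \<in> carrier G" "\<And>y. y \<in> carrier G \<Longrightarrow> a \<otimes> y \<otimes> inv a \<otimes> inv y \<in> N" by auto
    have "(g \<otimes> a \<otimes> inv g) \<otimes> y \<otimes> inv (g \<otimes> a \<otimes> inv g) \<otimes> inv y \<in> N" if y: "y \<in> carrier G" for y
    proof -
      have "g \<otimes> (a \<otimes> (inv g \<otimes> y \<otimes> g) \<otimes> inv a \<otimes> inv (inv g \<otimes> y \<otimes> g)) \<otimes> inv g \<in> N"
        using g y by (intro conj a(2)) auto
      then show ?thesis using a(1) g y by (simp add: group_word_simps)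
    qed
    then show "g \<otimes> a \<otimes> inv g \<in> ?Z" using a g by simp
  qed auto
qed

lemma upper_central_series_normal: "upper_central_series G n \<lhd> G"
proof (induction n)
  case 0
  then show ?case by (simp add: one_is_normal)
next
  case (Suc n)
  then show ?case using normal_preimage_of_centre by simp
qed

text \<open>Inside \<open>H\<close> fewer elements \<open>y\<close> have to be tested, so by
  induction no element of \<open>H\<close> is lost from any term.\<close>

lemma upper_central_series_subgroup:
  assumes "subgroup H G"
  shows "upper_central_series G n \<inter> H \<subseteq> upper_central_series (G\<lparr>carrier := H\<rparr>) n"
proof (induction n)
  case (Suc n)
  interpret H: subgroup H G by fact
  show ?case
  proof
    fix x assume x: "x \<in> upper_central_series G (Suc n) \<inter> H"
    have "x \<otimes> y \<otimes> inv x \<otimes> inv y \<in> upper_central_series (G\<lparr>carrier := H\<rparr>) n" if "y \<in> H" for y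
      using x that Suc by (auto intro!: H.m_closed H.m_inv_closed)
    then show "x \<in> upper_central_series (G\<lparr>carrier := H\<rparr>) (Suc n)"
      using x assms by simp
  qed
qed simp

lemma nilpotent_subgroup:
  assumes "nilpotent_group G" "subgroup H G"
  shows "nilpotent_group (G\<lparr>carrier := H\<rparr>)"
proof -
  interpret H: group "G\<lparr>carrier := H\<rparr>" using assms(2) by (rule subgroup_imp_group)
  obtain n where "upper_central_series G n = carrier G"
    using assms(1) unfolding nilpotent_group_def by blast
  then have "H \<subseteq> upper_central_series (G\<lparr>carrier := H\<rparr>) n"
    using upper_central_series_subgroup[OF assms(2), of n] subgroup.subset[OF assms(2)] by auto
  moreover have "upper_central_series (G\<lparr>carrier := H\<rparr>) n \<subseteq> H"
    using subgroup.subset[OF normal_imp_subgroup[OF H.upper_central_series_normal[of n]]] by simp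
  ultimately show ?thesis unfolding nilpotent_group_def using H.is_group by auto
qed

text \<open>
  If the commutator of \<open>x\<close> and \<open>y\<close> lies in a term of the upper central series, it is central modulo
  the previous term, where its order divides those of \<open>x\<close> and \<open>y\<close>; so it lies in that term too.
\<close>

lemma nilpotent_coprime_orders_commute:
  assumes "nilpotent_group G" and x: "x \<in> carrier G" and y: "y \<in> carrier G"
    and cop: "coprime (ord x) (ord y)"
  shows "x \<otimes> y = y \<otimes> x"
proof -
  define c where "c = x \<otimes> y \<otimes> inv x \<otimes> inv y"
  have c: "c \<in> carrier G" using x y by (simp add: c_def)
  have step: "c = \<one>" if "c \<in> upper_central_series G n" for n
    using that
  proof (induction n)
    case (Suc n)
    define N where "N = upper_central_series G n"
    interpret N: normal N G unfolding N_def by (rule upper_central_series_normal)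
    interpret Q: group "G Mod N" by (rule N.factorgroup_is_group)
    interpret h: group_hom G "G Mod N" "(#>) N"
      by unfold_locales (rule N.r_coset_hom_Mod)
    have trivial: "N #> u = \<one>\<^bsub>G Mod N\<^esub> \<longleftrightarrow> u \<in> N" if "u \<in> carrier G" for u
      using that by (metis N.subgroup_axioms N.mem_carrier coset_join1 coset_join2 one_FactGroup)
    \<comment> \<open>Membership of \<open>c\<close> in the next term of the series means that its
      image is central in \<open>G Mod N\<close>.\<close>
    have comm: "(N #> c) \<otimes>\<^bsub>G Mod N\<^esub> (N #> u) = (N #> u) \<otimes>\<^bsub>G Mod N\<^esub> (N #> c)" if u: "u \<in> carrier G" for u
    proof -
      have "c \<otimes> u \<otimes> inv c \<otimes> inv u \<in> N" using Suc.prems u by (simp add: N_def)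
      then have "N #> (c \<otimes> u \<otimes> inv c \<otimes> inv u) = \<one>\<^bsub>G Mod N\<^esub>"
        using trivial N.mem_carrier by blast
      then have "(N #> c) \<otimes>\<^bsub>G Mod N\<^esub> (N #> u) \<otimes>\<^bsub>G Mod N\<^esub> inv\<^bsub>G Mod N\<^esub> (N #> c) \<otimes>\<^bsub>G Mod N\<^esub> inv\<^bsub>G Mod N\<^esub> (N #> u)
          = \<one>\<^bsub>G Mod N\<^esub>"
        by (simp only: h.hom_mult h.hom_inv m_closed inv_closed c u)
      then show ?thesis
        using Q.commutator_eq_one_iff[OF h.hom_closed[OF c] h.hom_closed[OF u]] by blast
    qed
    have "x \<otimes> y = c \<otimes> (y \<otimes> x)" using x y by (simp add: c_def group_word_simps)
    then have "(N #> x) \<otimes>\<^bsub>G Mod N\<^esub> (N #> y) = (N #> c) \<otimes>\<^bsub>G Mod N\<^esub> ((N #> y) \<otimes>\<^bsub>G Mod N\<^esub> (N #> x))"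
      using x y c by (metis h.hom_mult m_closed)
    moreover have "(N #> x) [^]\<^bsub>G Mod N\<^esub> ord x = \<one>\<^bsub>G Mod N\<^esub>" "(N #> y) [^]\<^bsub>G Mod N\<^esub> ord y = \<one>\<^bsub>G Mod N\<^esub>"
      using x y by (simp_all flip: h.hom_nat_pow)
    ultimately have "N #> c = \<one>\<^bsub>G Mod N\<^esub>"
      using Q.trivial_commutator_of_coprime_orders[OF h.hom_closed[OF x] h.hom_closed[OF y] h.hom_closed[OF c]]
        comm x y cop by blast
    then show ?case using Suc.IH trivial c by (simp add: N_def)
  qed (use c in simp)
  obtain n where "upper_central_series G n = carrier G"
    using assms(1) unfolding nilpotent_group_def by blast
  then have "c = \<one>" using step c by blast
  then show ?thesis using x y commutator_eq_one_iff by (simp add: c_def)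
qed

text \<open>Let \<open>Z_k\<close> be the upper central series and \<open>k\<close> least such that
  \<open>C \<inter> Z_k\<close> is not inside \<open>A\<close>. For \<open>x\<close> in this
  intersection but outside \<open>A\<close>, all commutators lie in \<open>Z_(k-1)\<close>, and in
  \<open>C\<close> by normality, hence in \<open>A\<close>. So \<open>x\<close> is a nontrivial
  central element modulo \<open>A\<close>.\<close>

lemma nilpotent_central_modulo:
  assumes "nilpotent_group G" "A \<lhd> G" "C \<lhd> G" "\<not> C \<subseteq> A"
  obtains x where "x \<in> C" "x \<notin> A" "\<And>g. g \<in> carrier G \<Longrightarrow> x \<otimes> g \<otimes> inv x \<otimes> inv g \<in> A"
proof -
  interpret A: normal A G by fact
  interpret C: normal C G by fact
  obtain n where n: "upper_central_series G n = carrier G"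
    using assms(1) unfolding nilpotent_group_def by blast
  define k where "k = (LEAST k. \<not> C \<inter> upper_central_series G k \<subseteq> A)"
  have "\<not> C \<inter> upper_central_series G n \<subseteq> A" using n assms(4) C.subset by blast
  then have k: "\<not> C \<inter> upper_central_series G k \<subseteq> A" unfolding k_def by (rule LeastI)
  \<comment> \<open>\<open>k = 0\<close> is impossible, since the term with index 0 is trivial and
    \<open>A\<close> contains \<open>\<one>\<close>.\<close>
  then obtain j where j: "k = Suc j" by (cases k) auto
  then have sub: "C \<inter> upper_central_series G j \<subseteq> A"
    using not_less_Least[of j "\<lambda>k. \<not> C \<inter> upper_central_series G k \<subseteq> A"] by (auto simp: k_def)
  obtain x where x: "x \<in> C" "x \<in> upper_central_series G k" "x \<notin> A" using k by blast
  have "x \<otimes> g \<otimes> inv x \<otimes> inv g \<in> A" if g: "g \<in> carrier G" for g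
  proof -
    have "x \<otimes> (g \<otimes> inv x \<otimes> inv g) \<in> C"
      using x g by (intro C.m_closed C.inv_op_closed2 C.m_inv_closed)
    then show ?thesis using x g sub j by (simp add: m_assoc C.mem_carrier subset_iff)
  qed
  with x that show thesis by blast
qed

text \<open>\<open>x^(p^j)\<close> is the last of the iterated \<open>p\<close>-th powers of
  \<open>x\<close> before the chain first enters \<open>A\<close>. Such elements are what
  \<open>cyclic_prime_extension\<close> is applied to.\<close>

lemma prime_power_step_outside:
  assumes A: "subgroup A G" and x: "x \<in> carrier G" "x \<notin> A" and k: "x [^] (p ^ k :: nat) \<in> A"
  obtains j where "x [^] (p ^ j :: nat) \<notin> A" "(x [^] (p ^ j :: nat)) [^] p \<in> A"
proof -
  define n where "n = (LEAST n. x [^] (p ^ n :: nat) \<in> A)"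
  have n: "x [^] (p ^ n) \<in> A" unfolding n_def using k by (rule LeastI)
  with x obtain j where j: "n = Suc j" by (cases n) auto
  then have "x [^] (p ^ j) \<notin> A" using not_less_Least[of j "\<lambda>n. x [^] (p ^ n :: nat) \<in> A"] by (auto simp: n_def)
  moreover have "(x [^] (p ^ j)) [^] p \<in> A" using n j x by (simp add: nat_pow_pow mult.commute)
  ultimately show thesis using that by blast
qed

end

section \<open>Extending a cyclic normal subgroup\<close>

context group
begin

lemma conj_nat_pow:
  assumes "g \<in> carrier G" "x \<in> carrier G"
  shows "(g \<otimes> x \<otimes> inv g) [^] (k::nat) = g \<otimes> x [^] k \<otimes> inv g"
  using assms by (induction k) (simp_all add: group_word_simps)

lemma subgroup_nat_pow_closed:
  assumes "subgroup H G" "h \<in> H"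
  shows "h [^] (k::nat) \<in> H"
  using subgroup_int_pow_closed[OF assms, of "int k"] by (simp add: int_pow_int)

text \<open>Conjugation by \<open>b\<close> raises powers of \<open>a\<close> to the
  \<open>r\<close>-th power, so \<open>k\<close> passages multiply the exponent by
  \<open>r ^ k\<close>. Collecting the powers of \<open>a\<close> in \<open>(a^i b)^k\<close> on the
  left therefore adds up a geometric sum.\<close>

lemma conj_pow_exchange:
  assumes ab: "a \<in> carrier G" "b \<in> carrier G" and eq: "b \<otimes> a = a [^] (r::nat) \<otimes> b"
  shows "b \<otimes> a [^] (i::nat) = a [^] (i * r) \<otimes> b"
    and "b [^] (k::nat) \<otimes> a [^] (i::nat) = a [^] (i * r ^ k) \<otimes> b [^] k"
    and "(a [^] (i::nat) \<otimes> b) [^] k = a [^] (i * (\<Sum>j<k. r ^ j)) \<otimes> b [^] k"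
proof -
  have one: "b \<otimes> a [^] i = a [^] (i * r) \<otimes> b" for i :: nat
  proof (induction i)
    case (Suc i)
    have "b \<otimes> a [^] Suc i = (b \<otimes> a [^] i) \<otimes> a" using ab by (simp add: m_assoc)
    also have "\<dots> = a [^] (i * r) \<otimes> (b \<otimes> a)" unfolding Suc using ab by (simp add: m_assoc)
    also have "\<dots> = (a [^] (i * r) \<otimes> a [^] r) \<otimes> b" unfolding eq using ab by (simp add: m_assoc)
    also have "\<dots> = a [^] (Suc i * r) \<otimes> b" using ab by (simp add: nat_pow_mult add.commute)
    finally show ?case .
  qed (use ab in simp)
  then show "b \<otimes> a [^] i = a [^] (i * r) \<otimes> b" .
  have two: "b [^] k \<otimes> a [^] i = a [^] (i * r ^ k) \<otimes> b [^] k" for i k :: nat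
  proof (induction k arbitrary: i)
    case (Suc k)
    have "b [^] Suc k \<otimes> a [^] i = b [^] k \<otimes> (b \<otimes> a [^] i)" using ab by (simp add: m_assoc)
    also have "\<dots> = (b [^] k \<otimes> a [^] (i * r)) \<otimes> b" unfolding one using ab by (simp add: m_assoc)
    also have "\<dots> = a [^] (i * r ^ Suc k) \<otimes> b [^] Suc k"
      unfolding Suc using ab by (simp add: m_assoc mult.assoc)
    finally show ?case .
  qed (use ab in simp)
  then show "b [^] k \<otimes> a [^] i = a [^] (i * r ^ k) \<otimes> b [^] k" .
  show "(a [^] i \<otimes> b) [^] k = a [^] (i * (\<Sum>j<k. r ^ j)) \<otimes> b [^] k"
  proof (induction k)
    case (Suc k)
    have "(a [^] i \<otimes> b) [^] Suc k = a [^] (i * (\<Sum>j<k. r ^ j)) \<otimes> (b [^] k \<otimes> a [^] i) \<otimes> b"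
      using ab Suc by (simp add: m_assoc)
    also have "\<dots> = (a [^] (i * (\<Sum>j<k. r ^ j)) \<otimes> a [^] (i * r ^ k)) \<otimes> b [^] Suc k"
      unfolding two using ab by (simp add: m_assoc)
    also have "\<dots> = a [^] (i * (\<Sum>j<Suc k. r ^ j)) \<otimes> b [^] Suc k"
      using ab by (simp add: nat_pow_mult distrib_left)
    finally show ?case .
  qed (use ab in simp)
qed

text \<open>With \<open>b a b^-1 = a^r\<close> and \<open>b^p = a^s\<close> everything is arithmetic
  modulo \<open>p ^ m\<close>. If \<open>p\<close> does not divide \<open>s\<close>, then
  \<open>a\<close> is a power of \<open>b^p\<close>. Otherwise
  \<open>prime_power_extension_exponents\<close> yields either the quaternion relations or an
  \<open>i\<close> with \<open>(a^i b)^p = \<one>\<close>; in the latter case uniqueness puts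
  \<open>a^i b\<close> into \<open>\<langle>a\<rangle>\<close>, against \<open>b\<close> lying
  outside.\<close>

lemma cyclic_prime_extension:
  assumes fin: "finite (carrier G)" and p: "prime p"
    and a: "a \<in> carrier G" "ord a = p ^ m"
    and b: "b \<in> carrier G" "b \<notin> generate G {a}" "b [^] p \<in> generate G {a}"
      "b \<otimes> a \<otimes> inv b \<in> generate G {a}"
    and uniq: "\<And>u v. u \<in> carrier G \<Longrightarrow> v \<in> carrier G \<Longrightarrow> ord u = p \<Longrightarrow> ord v = p \<Longrightarrow> u \<in> generate G {v}"
  shows "a \<in> generate G {b} \<or>
    (p = 2 \<and> m \<ge> 2 \<and> b \<otimes> a \<otimes> inv b = inv a \<and> b [^] (2::nat) = a [^] (2 ^ (m - 1) :: nat))"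
proof (cases "m = 0")
  case True
  then have "a = \<one>" using a ord_eq_1 by simp
  then show ?thesis by (simp add: generate.one)
next
  case False
  then have m: "m \<ge> 1" by simp
  obtain r :: nat where r: "b \<otimes> a \<otimes> inv b = a [^] r" using in_generate_singletonE[OF fin a(1) b(4)] .
  obtain s :: nat where s: "b [^] p = a [^] s" using in_generate_singletonE[OF fin a(1) b(3)] .
  have "b \<otimes> a = (b \<otimes> a \<otimes> inv b) \<otimes> b" using a b by (simp add: group_word_simps)
  then have ba: "b \<otimes> a = a [^] r \<otimes> b" by (simp add: r)
  note exchange = conj_pow_exchange[OF a(1) b(1) ba]
  \<comment> \<open>\<open>b^p\<close> is a power of \<open>a\<close>, so conjugation by it fixes
    \<open>a\<close>: this is the condition on \<open>r ^ p\<close>.\<close>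
  have "a [^] (r ^ p) \<otimes> a [^] s = a [^] s \<otimes> a [^] (1::nat)"
    using exchange(2)[of p 1] a by (simp add: s)
  also have "\<dots> = a [^] (1::nat) \<otimes> a [^] s" using a(1) by (rule nat_pow_comm)
  finally have "a [^] (r ^ p) = a [^] (1::nat)" using a(1) by simp
  then have "[r ^ p = 1] (mod p ^ m)" unfolding nat_pow_eq_iff_cong[OF a(1)] a(2) .
  then have rp: "int p ^ m dvd int r ^ p - 1"
    by (metis cong_iff_dvd_diff cong_int_iff of_nat_1 of_nat_power)
  \<comment> \<open>\<open>b^p = a^s\<close> commutes with \<open>b\<close>, while conjugation by
    \<open>b\<close> turns it into \<open>a^(s r)\<close>.\<close>
  have "a [^] (s * r) \<otimes> b = a [^] s \<otimes> b"
  proof -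
    have "a [^] (s * r) \<otimes> b = b \<otimes> b [^] p" using exchange(1)[of s] by (simp add: s)
    also have "\<dots> = b [^] p \<otimes> b" using b(1) group_commutes_pow[of b b] by metis
    finally show ?thesis by (simp add: s)
  qed
  then have "a [^] (s * r) = a [^] s" using a b by simp
  then have "[s * r = s] (mod p ^ m)" unfolding nat_pow_eq_iff_cong[OF a(1)] a(2) .
  then have "[int s * int r = int s] (mod int p ^ m)"
    by (metis cong_int_iff of_nat_mult of_nat_power)
  then have sr: "int p ^ m dvd int s * (int r - 1)"
    by (simp add: cong_iff_dvd_diff right_diff_distrib)
  show ?thesis
  proof (cases "p dvd s")
    case False
    then have "coprime s (p ^ m)" using p by (metis coprime_commute coprime_power_left_iff prime_imp_coprime)
    then obtain t where "[s * t = 1] (mod p ^ m)" using cong_solve_coprime_nat by (metis One_nat_def)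
    then have "a [^] (s * t) = a [^] (1::nat)" unfolding nat_pow_eq_iff_cong[OF a(1)] a(2) .
    then have "a = (b [^] p) [^] t" using a(1) by (simp add: s nat_pow_pow)
    then have "a = b [^] (p * t)" using b(1) by (simp add: nat_pow_pow)
    then show ?thesis using nat_pow_in_generate_singleton[OF b(1)] by metis
  next
    case True
    from prime_power_extension_exponents[OF p m True rp sr] consider
      i where "p ^ m dvd i * (\<Sum>j<p. r ^ j) + s"
      | "p = 2" "m \<ge> 2" "2 ^ m dvd r + 1" "int 2 ^ m dvd int s - 2 ^ (m - 1)" by blast
    then show ?thesis
    proof cases
      case 1
      define u where "u = a [^] i \<otimes> b"
      have u: "u \<in> carrier G" using a b by (simp add: u_def)
      have "u [^] p = a [^] (i * (\<Sum>j<p. r ^ j) + s)"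
        using a(1) by (simp add: u_def exchange(3) s nat_pow_mult)
      also have "\<dots> = \<one>" using 1 a by (simp add: pow_eq_id)
      finally have "ord u dvd p" using u pow_eq_id by blast
      then have "ord u = 1 \<or> ord u = p" using p by (simp add: prime_nat_iff)
      then have "u \<in> generate G {a}"
      proof
        assume "ord u = 1"
        then show ?thesis using u ord_eq_1 generate.one by metis
      next
        assume ou: "ord u = p"
        \<comment> \<open>A generator of the subgroup of order \<open>p\<close> in
          \<open>\<langle>a\<rangle>\<close>, with which uniqueness compares
          \<open>u\<close>.\<close>
        define w where "w = a [^] (p ^ (m - 1))"
        have pm: "p ^ m = p ^ (m - 1) * p" using m by (cases m) auto
        have "ord w = p"
          unfolding w_def using p by (subst ord_pow) (use a pm in auto)
        moreover have "w \<in> carrier G" using a by (simp add: w_def)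
        ultimately have "u \<in> generate G {w}" using uniq u ou by blast
        then show ?thesis
          using generate_singleton_mono[OF a(1)] nat_pow_in_generate_singleton[OF a(1)] unfolding w_def by blast
      qed
      moreover have "subgroup (generate G {a}) G" using a by (simp add: generate_is_subgroup)
      ultimately have "inv (a [^] i) \<otimes> u \<in> generate G {a}"
        using nat_pow_in_generate_singleton[OF a(1)] by (simp add: subgroup.m_closed subgroup.m_inv_closed)
      then have "b \<in> generate G {a}" using a b by (simp add: u_def inv_mult_cancel_left)
      with b show ?thesis by blast
    next
      case 2
      have "a [^] (r + 1) = \<one>" unfolding pow_eq_id[OF a(1)] a(2) using 2 by simp
      then have "a [^] r \<otimes> a = \<one>" using a by simp
      then have "b \<otimes> a \<otimes> inv b = inv a" using a r by (simp add: inv_equality)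
      moreover have "[s = 2 ^ (m - 1)] (mod 2 ^ m)"
        using 2(4) by (metis cong_iff_dvd_diff cong_int_iff of_nat_numeral of_nat_power)
      then have "a [^] s = a [^] (2 ^ (m - 1) :: nat)"
        unfolding nat_pow_eq_iff_cong[OF a(1)] a(2) using 2(1) by simp
      ultimately show ?thesis using 2 s by simp
    qed
  qed
qed

text \<open>For \<open>y\<close> in \<open>A\<close> the conjugate \<open>g^-1 y g\<close> is again
  in \<open>A\<close>, so \<open>x\<close> commutes with it; conjugating back by \<open>g\<close>
  gives the commutation for \<open>g x g^-1\<close>.\<close>

lemma centralizer_normal:
  assumes "A \<lhd> G"
  shows "{x \<in> carrier G. \<forall>y\<in>A. x \<otimes> y = y \<otimes> x} \<lhd> G" (is "?C \<lhd> G")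
proof -
  interpret A: normal A G by fact
  show ?thesis unfolding normal_inv_iff
  proof (intro conjI ballI subgroupI)
    show "?C \<noteq> {}" using A.mem_carrier by (auto intro!: exI[of _ \<one>])
  next
    fix x assume "x \<in> ?C"
    then have x: "x \<in> carrier G" "\<And>y. y \<in> A \<Longrightarrow> x \<otimes> y = y \<otimes> x" by auto
    have "inv x \<otimes> y = y \<otimes> inv x" if y: "y \<in> A" for y
    proof -
      have yc: "y \<in> carrier G" using y A.mem_carrier by blast
      have "inv x \<otimes> y = inv x \<otimes> (y \<otimes> x) \<otimes> inv x" using x(1) yc by (simp add: m_assoc)
      also have "\<dots> = y \<otimes> inv x" unfolding x(2)[OF y, symmetric] using x(1) yc by (simp add: group_word_simps)
      finally show ?thesis .
    qed
    then show "inv x \<in> ?C" using x(1) by simp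
  next
    fix x z assume "x \<in> ?C" "z \<in> ?C"
    then have x: "x \<in> carrier G" "\<And>y. y \<in> A \<Longrightarrow> x \<otimes> y = y \<otimes> x"
      and z: "z \<in> carrier G" "\<And>y. y \<in> A \<Longrightarrow> z \<otimes> y = y \<otimes> z" by auto
    have "x \<otimes> z \<otimes> y = y \<otimes> (x \<otimes> z)" if y: "y \<in> A" for y
    proof -
      have yc: "y \<in> carrier G" using y A.mem_carrier by blast
      have "x \<otimes> z \<otimes> y = (x \<otimes> y) \<otimes> z" using x(1) z(1) yc by (simp add: m_assoc z(2)[OF y])
      then show ?thesis unfolding x(2)[OF y] using x(1) z(1) yc by (simp add: m_assoc)
    qed
    then show "x \<otimes> z \<in> ?C" using x(1) z(1) by simp
  next
    fix g x assume g: "g \<in> carrier G" and "x \<in> ?C"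
    then have x: "x \<in> carrier G" "\<And>y. y \<in> A \<Longrightarrow> x \<otimes> y = y \<otimes> x" by auto
    have "g \<otimes> x \<otimes> inv g \<otimes> y = y \<otimes> (g \<otimes> x \<otimes> inv g)" if y: "y \<in> A" for y
    proof -
      have yc: "y \<in> carrier G" using y A.mem_carrier by blast
      have "g \<otimes> x \<otimes> inv g \<otimes> y = g \<otimes> (x \<otimes> (inv g \<otimes> y \<otimes> g)) \<otimes> inv g"
        using x(1) g yc by (simp add: group_word_simps)
      also have "x \<otimes> (inv g \<otimes> y \<otimes> g) = (inv g \<otimes> y \<otimes> g) \<otimes> x"
        by (rule x(2)) (rule A.inv_op_closed1[OF g y])
      also have "g \<otimes> ((inv g \<otimes> y \<otimes> g) \<otimes> x) \<otimes> inv g = y \<otimes> (g \<otimes> x \<otimes> inv g)"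
        using x(1) g yc by (simp add: group_word_simps)
      finally show ?thesis .
    qed
    then show "g \<otimes> x \<otimes> inv g \<in> ?C" using x(1) g by simp
  qed auto
qed

lemma generate_singleton_normal:
  assumes fin: "finite (carrier G)" and x: "x \<in> carrier G"
    and conj: "\<And>g. g \<in> carrier G \<Longrightarrow> g \<otimes> x \<otimes> inv g \<in> generate G {x}"
  shows "generate G {x} \<lhd> G"
  unfolding normal_inv_iff
proof (intro conjI ballI)
  show sub: "subgroup (generate G {x}) G" using x by (simp add: generate_is_subgroup)
  fix g h assume g: "g \<in> carrier G" and h: "h \<in> generate G {x}"
  obtain k :: nat where "h = x [^] k" using in_generate_singletonE[OF fin x h] .
  then have "g \<otimes> h \<otimes> inv g = (g \<otimes> x \<otimes> inv g) [^] k" using conj_nat_pow g x by simp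
  then show "g \<otimes> h \<otimes> inv g \<in> generate G {x}" using subgroup_nat_pow_closed[OF sub conj[OF g]] by simp
qed

lemma commutes_with_generate_singleton:
  assumes fin: "finite (carrier G)" and a: "a \<in> carrier G" and x: "x \<in> carrier G" "x \<otimes> a = a \<otimes> x"
    and y: "y \<in> generate G {a}"
  shows "x \<otimes> y = y \<otimes> x"
proof -
  obtain k :: nat where "y = a [^] k" using in_generate_singletonE[OF fin a y] .
  then show ?thesis using group_commutes_pow[of a x k] a x by simp
qed

lemma cyclic_group_iff_generate:
  "cyclic_group G \<longleftrightarrow> (\<exists>x\<in>carrier G. generate G {x} = carrier G)"
proof -
  have "generate G {x} = range (\<lambda>n::int. x [^] n)" if "x \<in> carrier G" for x
    using generate_pow[OF that] by auto
  then show ?thesis unfolding cyclic_group by metis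
qed

section \<open>Maximal cyclic normal subgroups and the classification of p-groups\<close>

lemma maximal_normal_cyclic:
  assumes fin: "finite (carrier G)"
  obtains a where "a \<in> carrier G" "generate G {a} \<lhd> G"
    "\<And>b. b \<in> carrier G \<Longrightarrow> generate G {b} \<lhd> G \<Longrightarrow> ord b \<le> ord a"
proof -
  define S where "S = {a \<in> carrier G. generate G {a} \<lhd> G}"
  have "generate G {\<one>} = {\<one>}" by (simp add: generate_one)
  then have "\<one> \<in> S" by (simp add: S_def one_is_normal)
  moreover have "finite S" using fin by (simp add: S_def)
  ultimately have M: "finite (ord ` S)" "ord ` S \<noteq> {}" by auto
  then obtain a where a: "a \<in> S" "ord a = Max (ord ` S)" using Max_in by (metis imageE)
  then have "ord b \<le> ord a" if "b \<in> S" for b using M that by simp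
  with a that show thesis unfolding S_def by blast
qed

text \<open>If the centralizer \<open>C\<close> of \<open>A = \<langle>a\<rangle>\<close> were
  larger than \<open>A\<close>, nilpotency would give an element of \<open>C\<close> outside
  \<open>A\<close> that is central modulo \<open>A\<close>, and a power \<open>z\<close> of it,
  still outside, with \<open>z^p\<close> in \<open>A\<close>. Either \<open>A\<close> lies properly
  in \<open>\<langle>z\<rangle>\<close>, which is normal because \<open>z\<close> is central modulo
  \<open>A\<close>, against maximality; or \<open>z\<close> both centralizes and inverts
  \<open>a\<close>, impossible as \<open>a\<close> then has order at least 4.\<close>

lemma generate_singleton_self_centralizing:
  assumes nil: "nilpotent_group G" and pG: "p_group p G"
    and uniq: "\<And>u v. u \<in> carrier G \<Longrightarrow> v \<in> carrier G \<Longrightarrow> ord u = p \<Longrightarrow> ord v = p \<Longrightarrow> u \<in> generate G {v}"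
    and a: "a \<in> carrier G" "generate G {a} \<lhd> G"
    and max: "\<And>b. b \<in> carrier G \<Longrightarrow> generate G {b} \<lhd> G \<Longrightarrow> ord b \<le> ord a"
    and x: "x \<in> carrier G" "x \<otimes> a = a \<otimes> x"
  shows "x \<in> generate G {a}"
proof (rule ccontr)
  assume "x \<notin> generate G {a}"
  have p: "prime p" and fin: "finite (carrier G)" and "\<exists>n. order G = p ^ n"
    using pG unfolding p_group_def by auto
  then obtain n where n: "order G = p ^ n" by blast
  define A where "A = generate G {a}"
  define C where "C = {x \<in> carrier G. \<forall>y\<in>A. x \<otimes> y = y \<otimes> x}"
  \<comment> \<open>The preimage of the centre of \<open>G Mod A\<close>; being a subgroup, it
    contains with \<open>y\<close> the power \<open>z\<close>.\<close>
  define Z where "Z = {x \<in> carrier G. \<forall>g \<in> carrier G. x \<otimes> g \<otimes> inv x \<otimes> inv g \<in> A}"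
  have A: "A \<lhd> G" using a by (simp add: A_def)
  interpret A: normal A G by (rule A)
  have C: "C \<lhd> G" unfolding C_def by (rule centralizer_normal[OF A])
  have Z: "Z \<lhd> G" unfolding Z_def by (rule normal_preimage_of_centre[OF A])
  have "x \<in> C" using commutes_with_generate_singleton[OF fin a(1) x] x by (auto simp: C_def A_def)
  then have "\<not> C \<subseteq> A" using \<open>x \<notin> generate G {a}\<close> by (auto simp: A_def)
  then obtain y where y: "y \<in> C" "y \<notin> A" "\<And>g. g \<in> carrier G \<Longrightarrow> y \<otimes> g \<otimes> inv y \<otimes> inv g \<in> A"
    using nilpotent_central_modulo[OF nil A C] by blast
  have yc: "y \<in> carrier G" using y(1) by (simp add: C_def)
  then have yZ: "y \<in> Z" using y(3) by (simp add: Z_def)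
  have "y [^] (p ^ n) \<in> A" using pow_order_eq_1[OF yc] by (simp add: n)
  from prime_power_step_outside[OF A.subgroup_axioms yc y(2) this]
  obtain j where j: "y [^] (p ^ j :: nat) \<notin> A" "(y [^] (p ^ j :: nat)) [^] p \<in> A"
    by blast
  define z where "z = y [^] (p ^ j)"
  have zc: "z \<in> carrier G" using yc by (simp add: z_def)
  have zZ: "z \<in> Z" and zC: "z \<in> C"
    using subgroup_nat_pow_closed[OF normal_imp_subgroup] Z C yZ y(1) by (auto simp: z_def)
  have za: "z \<otimes> a = a \<otimes> z" using zC self_in_generate_singleton[of a] by (simp add: C_def A_def)
  have conj: "z \<otimes> a \<otimes> inv z = a" using za zc a(1) by (simp add: m_assoc)
  have "ord a dvd p ^ n" using ord_dvd_group_order[OF a(1)] n by simp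
  then obtain m where m: "ord a = p ^ m" using p divides_primepow_nat by blast
  have "a \<in> generate G {z} \<or>
    (p = 2 \<and> m \<ge> 2 \<and> z \<otimes> a \<otimes> inv z = inv a \<and> z [^] (2::nat) = a [^] (2 ^ (m - 1) :: nat))"
  proof (rule cyclic_prime_extension[OF fin p a(1) m zc _ _ _ uniq])
    show "z \<notin> generate G {a}" "z [^] p \<in> generate G {a}" using j by (simp_all add: A_def z_def)
    show "z \<otimes> a \<otimes> inv z \<in> generate G {a}" unfolding conj by (rule self_in_generate_singleton)
  qed
  then show False
  proof
    assume az: "a \<in> generate G {z}"
    then have sub: "A \<subseteq> generate G {z}" using generate_singleton_mono[OF zc] by (simp add: A_def)
    have gz: "subgroup (generate G {z}) G" using zc by (simp add: generate_is_subgroup)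
    have "generate G {z} \<lhd> G"
    proof (rule generate_singleton_normal[OF fin zc])
      fix g assume g: "g \<in> carrier G"
      \<comment> \<open>Times \<open>z\<close>, the inverse commutator is the conjugate
        \<open>g z g^-1\<close>, which thus lies in the coset \<open>A z\<close>.\<close>
      have "inv (z \<otimes> g \<otimes> inv z \<otimes> inv g) \<in> A" using zZ g by (intro A.m_inv_closed) (simp add: Z_def)
      then have "inv (z \<otimes> g \<otimes> inv z \<otimes> inv g) \<otimes> z \<in> generate G {z}"
        by (rule subgroup.m_closed[OF gz subsetD[OF sub] self_in_generate_singleton])
      then show "g \<otimes> z \<otimes> inv g \<in> generate G {z}" using g zc by (simp add: group_word_simps)
    qed
    then have "card (generate G {z}) \<le> card A"
      using max[OF zc] generate_pow_card[OF zc] generate_pow_card[OF a(1)] by (simp add: A_def)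
    moreover have "finite (generate G {z})"
      using generate_incl[of "{z}"] zc fin finite_subset by blast
    ultimately have "A = generate G {z}" using sub by (simp add: card_seteq)
    then show False using j(1) self_in_generate_singleton[of z] by (simp add: z_def)
  next
    assume *: "p = 2 \<and> m \<ge> 2 \<and> z \<otimes> a \<otimes> inv z = inv a \<and> z [^] (2::nat) = a [^] (2 ^ (m - 1) :: nat)"
    then have "inv a = a" using conj by simp
    then have "a \<otimes> a = \<one>" using r_inv[OF a(1)] by simp
    then have "a [^] (2::nat) = \<one>" using a(1) by (simp add: numeral_2_eq_2)
    then have "2 ^ m dvd (2::nat)" using pow_eq_id[OF a(1)] m * by simp
    then have "2 ^ m \<le> (2::nat)" by (simp add: dvd_imp_le)
    moreover have "(2::nat) ^ 2 \<le> 2 ^ m" using * by (intro power_increasing) auto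
    ultimately show False by simp
  qed
qed

text \<open>For positive \<open>j\<close> the power is a square, and no square is \<open>-1\<close>
  modulo 4, which divides \<open>2 ^ m\<close>.\<close>

lemma two_power_not_neg_one_square:
  fixes r j m :: nat
  assumes "2 ^ m dvd r ^ (2 ^ j) + 1" "m \<ge> 2"
  shows "j = 0"
proof (rule ccontr)
  assume "j \<noteq> 0"
  then obtain i where "j = Suc i" by (cases j) auto
  then have "r ^ (2 ^ j) = (r ^ 2 ^ i)\<^sup>2" by (simp add: mult.commute flip: power_mult)
  moreover have "(4::nat) dvd 2 ^ m" using le_imp_power_dvd[OF assms(2), of 2] by simp
  ultimately have "4 dvd (r ^ 2 ^ i)\<^sup>2 + 1" using assms(1) dvd_trans by metis
  moreover have "\<not> 4 dvd q\<^sup>2 + 1" for q :: nat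
  proof (cases "even q")
    case True
    then obtain k where "q = 2 * k" by blast
    then have "q\<^sup>2 + 1 = 4 * k\<^sup>2 + 1" by (simp add: power2_eq_square)
    then show ?thesis by presburger
  next
    case False
    then obtain k where "q = 2 * k + 1" by (rule oddE)
    then have "q\<^sup>2 + 1 = 4 * (k\<^sup>2 + k) + 2" by (simp add: power2_eq_square algebra_simps)
    then show ?thesis by presburger
  qed
  ultimately show False by blast
qed

theorem p_group_unique_prime_order_subgroup:
  assumes nil: "nilpotent_group G" and pG: "p_group p G"
    and uniq: "\<And>u v. u \<in> carrier G \<Longrightarrow> v \<in> carrier G \<Longrightarrow> ord u = p \<Longrightarrow> ord v = p \<Longrightarrow> u \<in> generate G {v}"
  shows "cyclic_group G \<or> generalized_quaternion_2_group G"
proof -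
  have p: "prime p" and fin: "finite (carrier G)" and "\<exists>n. order G = p ^ n"
    using pG unfolding p_group_def by auto
  then obtain n where n: "order G = p ^ n" by blast
  obtain a where a: "a \<in> carrier G" "generate G {a} \<lhd> G"
    and max: "\<And>b. b \<in> carrier G \<Longrightarrow> generate G {b} \<lhd> G \<Longrightarrow> ord b \<le> ord a"
    using maximal_normal_cyclic[OF fin] by blast
  define A where "A = generate G {a}"
  interpret A: normal A G using a by (simp add: A_def)
  have aA: "a \<in> A" by (simp add: A_def self_in_generate_singleton)
  have self_centr: "x \<in> A" if "x \<in> carrier G" "x \<otimes> a = a \<otimes> x" for x
    unfolding A_def by (rule generate_singleton_self_centralizing[OF nil pG uniq a max that])
  have "ord a dvd p ^ n" using ord_dvd_group_order[OF a(1)] n by simp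
  then obtain m where m: "ord a = p ^ m" using p divides_primepow_nat by blast
  have extension: "p = 2 \<and> m \<ge> 2 \<and> b \<otimes> a \<otimes> inv b = inv a \<and> b [^] (2::nat) = a [^] (2 ^ (m - 1) :: nat)"
    if b: "b \<in> carrier G" "b \<notin> A" "b [^] p \<in> A" for b
  proof -
    \<comment> \<open>Otherwise \<open>b\<close> would commute with its power \<open>a\<close> and
      fall into the self-centralizing \<open>A\<close>.\<close>
    have "a \<notin> generate G {b}"
    proof
      assume ab: "a \<in> generate G {b}"
      have "b \<otimes> a = a \<otimes> b" by (rule commutes_with_generate_singleton[OF fin b(1) b(1) refl ab])
      with self_centr b show False by blast
    qed
    moreover have "b \<otimes> a \<otimes> inv b \<in> generate G {a}" using A.inv_op_closed2[OF b(1) aA] by (simp add: A_def)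
    ultimately show ?thesis
      using cyclic_prime_extension[OF fin p a(1) m b(1) _ _ _ uniq] b unfolding A_def by blast
  qed
  show ?thesis
  proof (cases "A = carrier G")
    case True
    then show ?thesis unfolding cyclic_group_iff_generate A_def using a by blast
  next
    case False
    then obtain c0 where c0: "c0 \<in> carrier G" "c0 \<notin> A" using A.subset by blast
    have power: "\<exists>j. c [^] (p ^ j :: nat) \<notin> A \<and> (c [^] (p ^ j :: nat)) [^] p \<in> A"
      if c: "c \<in> carrier G" "c \<notin> A" for c
    proof -
      have "c [^] (p ^ n) \<in> A" using pow_order_eq_1[OF c(1)] by (simp add: n)
      from prime_power_step_outside[OF A.subgroup_axioms c this] show ?thesis by blast
    qed
    obtain j where j: "c0 [^] (p ^ j :: nat) \<notin> A" "(c0 [^] (p ^ j :: nat)) [^] p \<in> A"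
      using power[OF c0] by blast
    define b where "b = c0 [^] (p ^ j)"
    have b: "b \<in> carrier G" "b \<notin> A" "b [^] p \<in> A" using j c0 by (simp_all add: b_def)
    have p2: "p = 2" and m2: "m \<ge> 2" and b_inv: "b \<otimes> a \<otimes> inv b = inv a"
      and b_sq: "b [^] (2::nat) = a [^] (2 ^ (m - 1) :: nat)"
      using extension[OF b] by auto
    \<comment> \<open>Some \<open>c^(2^i)\<close> meets the hypotheses of \<open>extension\<close>
      and so inverts \<open>a\<close>. If \<open>c\<close> conjugates \<open>a\<close> to
      \<open>a^r\<close>, then \<open>r ^ 2 ^ i\<close> is \<open>-1\<close> modulo
      \<open>2 ^ m\<close>, which forces \<open>i = 0\<close>: \<open>c\<close> itself inverts
      \<open>a\<close>.\<close>
    have inverts: "c \<otimes> a \<otimes> inv c = inv a" if c: "c \<in> carrier G" "c \<notin> A" for c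
    proof -
      obtain i where i: "c [^] (p ^ i :: nat) \<notin> A" "(c [^] (p ^ i :: nat)) [^] p \<in> A"
        using power[OF c] by blast
      have "c \<otimes> a \<otimes> inv c \<in> generate G {a}" using A.inv_op_closed2[OF c(1) aA] by (simp add: A_def)
      then obtain r :: nat where r: "c \<otimes> a \<otimes> inv c = a [^] r"
        using in_generate_singletonE[OF fin a(1)] by metis
      have "c \<otimes> a = (c \<otimes> a \<otimes> inv c) \<otimes> c" using a(1) c by (simp add: group_word_simps)
      then have "c \<otimes> a = a [^] r \<otimes> c" by (simp add: r)
      from conj_pow_exchange(2)[OF a(1) c(1) this, of "2 ^ i" 1]
      have ex: "c [^] (2 ^ i :: nat) \<otimes> a = a [^] (r ^ 2 ^ i) \<otimes> c [^] (2 ^ i :: nat)" using a(1) by simp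
      have "c [^] (2 ^ i :: nat) \<otimes> a \<otimes> inv (c [^] (2 ^ i :: nat)) = inv a"
        using extension[OF _ i] c p2 by simp
      moreover have "c [^] (2 ^ i :: nat) \<otimes> a \<otimes> inv (c [^] (2 ^ i :: nat)) = a [^] (r ^ 2 ^ i)"
        unfolding ex using a(1) c by (simp add: m_assoc)
      ultimately have "a [^] (r ^ 2 ^ i) = inv a" by simp
      then have "a [^] (r ^ 2 ^ i) \<otimes> a = \<one>" using a(1) by simp
      then have "a [^] (r ^ 2 ^ i + 1) = \<one>" using a(1) by simp
      then have "2 ^ m dvd r ^ 2 ^ i + 1" unfolding pow_eq_id[OF a(1)] m p2 .
      then have "i = 0" using two_power_not_neg_one_square m2 by blast
      then show ?thesis using extension[of c] i c by simp
    qed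
    have swap: "c \<otimes> a = inv a \<otimes> c" if c: "c \<in> carrier G" "c \<notin> A" for c
    proof -
      have "c \<otimes> a = (c \<otimes> a \<otimes> inv c) \<otimes> c" using a(1) c by (simp add: group_word_simps)
      then show ?thesis by (simp add: inverts[OF c])
    qed
    \<comment> \<open>\<open>c\<close> and \<open>b\<close> both invert \<open>a\<close>, so their
      product centralizes it.\<close>
    have prod: "c \<otimes> b \<in> A" if c: "c \<in> carrier G" "c \<notin> A" for c
    proof (rule self_centr)
      have "a \<otimes> c = a \<otimes> (c \<otimes> a) \<otimes> inv a" using a(1) c by (simp add: group_word_simps)
      also have "\<dots> = c \<otimes> inv a" unfolding swap[OF c] using a(1) c by (simp add: group_word_simps)
      finally have ac: "a \<otimes> c = c \<otimes> inv a" .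
      have "c \<otimes> b \<otimes> a = c \<otimes> (inv a \<otimes> b)" using a(1) b(1) c by (simp add: m_assoc swap[OF b(1,2)])
      also have "\<dots> = a \<otimes> (c \<otimes> b)" using ac a(1) b(1) c by (simp flip: m_assoc)
      finally show "c \<otimes> b \<otimes> a = a \<otimes> (c \<otimes> b)" .
    qed (use b c in simp)
    \<comment> \<open>The complement of \<open>A\<close> is a single coset, so \<open>A\<close> has
      index 2.\<close>
    have coset: "carrier G - A = (\<lambda>y. y \<otimes> inv b) ` A"
    proof (intro equalityI subsetI)
      fix c assume "c \<in> carrier G - A"
      then have "c \<otimes> b \<in> A" "c = (c \<otimes> b) \<otimes> inv b" using prod b by (auto simp: m_assoc)
      then show "c \<in> (\<lambda>y. y \<otimes> inv b) ` A" by blast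
    next
      fix c assume "c \<in> (\<lambda>y. y \<otimes> inv b) ` A"
      then obtain y where y: "y \<in> A" "c = y \<otimes> inv b" by blast
      have "y \<otimes> inv b \<notin> A"
      proof
        assume "y \<otimes> inv b \<in> A"
        then have "inv (y \<otimes> inv b) \<otimes> y \<in> A" using y by blast
        then show False using y b A.mem_carrier by (simp add: group_word_simps)
      qed
      then show "c \<in> carrier G - A" using y b A.mem_carrier by simp
    qed
    have finA: "finite A" using fin A.subset finite_subset by blast
    have "card (carrier G - A) = card A"
      unfolding coset using b A.mem_carrier by (intro card_image inj_onI) simp
    then have "card (carrier G) = 2 * card A"
      using card_Diff_subset[OF finA A.subset] card_mono[OF fin A.subset] by simp
    then have ord_G: "order G = 2 ^ (m + 1)"
      using generate_pow_card[OF a(1)] m p2 by (simp add: order_def A_def)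
    have gen: "generate G {a, b} = carrier G"
    proof
      show "generate G {a, b} \<subseteq> carrier G" using a b by (simp add: generate_incl)
      have Asub: "A \<subseteq> generate G {a, b}" unfolding A_def by (rule mono_generate) simp
      show "carrier G \<subseteq> generate G {a, b}"
      proof
        fix c assume "c \<in> carrier G"
        show "c \<in> generate G {a, b}"
        proof (cases "c \<in> A")
          case False
          then obtain y where "y \<in> A" "c = y \<otimes> inv b" using coset \<open>c \<in> carrier G\<close> by blast
          then show ?thesis using Asub by (auto intro: generate.eng generate.inv)
        qed (use Asub in blast)
      qed
    qed
    have "inv b \<otimes> a \<otimes> b = inv a"
    proof -
      have "inv b \<otimes> a \<otimes> b = inv (inv b \<otimes> inv a \<otimes> b)" using a(1) b(1) by (simp add: group_word_simps)
      also have "inv b \<otimes> inv a \<otimes> b = inv b \<otimes> (b \<otimes> a \<otimes> inv b) \<otimes> b" by (simp add: b_inv)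
      also have "\<dots> = a" using a(1) b(1) by (simp add: group_word_simps)
      finally show ?thesis .
    qed
    moreover have "a [^] (2 ^ m :: nat) = \<one>" using a(1) m p2 by (metis pow_ord_eq_1)
    \<comment> \<open>The parameter of the presentation is \<open>m + 1\<close>, so its exponents
      are \<open>2 ^ m\<close> and \<open>2 ^ (m - 1)\<close>.\<close>
    ultimately have rels: "generate G {a, b} = carrier G \<and> a [^] (2 ^ (m + 1 - 1) :: nat) = \<one> \<and>
        b [^] (2::nat) = a [^] (2 ^ (m + 1 - 2) :: nat) \<and> inv b \<otimes> a \<otimes> b = inv a"
      using gen b_sq m2 by simp
    have "generalized_quaternion_2_group G"
      unfolding generalized_quaternion_2_group_def
    proof (intro conjI exI[of _ "m + 1"])
      show "group G" by (rule is_group)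
      show "3 \<le> m + 1" using m2 by simp
      show "order G = 2 ^ (m + 1)" by (rule ord_G)
      show "\<exists>x\<in>carrier G. \<exists>y\<in>carrier G. generate G {x, y} = carrier G \<and>
          x [^] (2 ^ (m + 1 - 1) :: nat) = \<one> \<and> y [^] (2::nat) = x [^] (2 ^ (m + 1 - 2) :: nat) \<and>
          inv y \<otimes> x \<otimes> y = inv x"
        using rels a(1) b(1) by blast
    qed
    then show ?thesis by blast
  qed
qed

end

section \<open>Sylow subgroups of nilpotent groups\<close>

context group
begin

text \<open>The elements \<open>x^i\<close> and \<open>x^i y\<close> form a set closed under
  products that contains the generators and their inverses, hence everything. Counting then gives
  \<open>x\<close> order at least \<open>2 ^ (n - 1)\<close>, so \<open>y^2\<close> is nontrivial.
  As \<open>(x^i y)^2 = y^2\<close>, every involution lies in the cyclic group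
  \<open>\<langle>x\<rangle>\<close>, which has only one.\<close>

lemma generalized_quaternion_unique_involution:
  assumes gq: "generalized_quaternion_2_group G" and fin: "finite (carrier G)"
    and u: "u \<in> carrier G" "ord u = 2" and v: "v \<in> carrier G" "ord v = 2"
  shows "u \<in> generate G {v}"
proof -
  obtain n x y where n: "n \<ge> 3" "order G = 2 ^ n" and x: "x \<in> carrier G" and y: "y \<in> carrier G"
    and gen: "generate G {x, y} = carrier G" and xN: "x [^] (2 ^ (n - 1) :: nat) = \<one>"
    and y2: "y [^] (2::nat) = x [^] (2 ^ (n - 2) :: nat)" and conj: "inv y \<otimes> x \<otimes> y = inv x"
    using gq unfolding generalized_quaternion_2_group_def by auto
  \<comment> \<open>\<open>x^N\<close> is trivial and \<open>N = 2 M\<close>; with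
    \<open>r = N - 1\<close> the inverse of \<open>x\<close> is the natural power
    \<open>x^r\<close>.\<close>
  define N M r where "N = (2::nat) ^ (n - 1)" and "M = (2::nat) ^ (n - 2)" and "r = N - 1"
  have "n - 1 = Suc (n - 2)" using n by simp
  then have NM: "N = 2 * M" by (simp add: N_def M_def)
  have M0: "M > 0" by (simp add: M_def)
  have r1: "r + 1 = N" using NM M0 by (simp add: r_def)
  have xN: "x [^] N = \<one>" and y2: "y \<otimes> y = x [^] M"
    using xN y2 y by (simp_all add: N_def M_def numeral_2_eq_2)
  have "x [^] r \<otimes> x = \<one>" using xN x by (simp flip: r1)
  then have xr: "inv x = x [^] r" using x by (simp add: inv_equality)
  have "y \<otimes> inv x = x \<otimes> y" using x y by (simp add: group_word_simps flip: conj)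
  then have "y \<otimes> x = inv x \<otimes> y" using x y by (metis inv_closed inv_solve_left inv_solve_right m_assoc m_closed)
  then have yx: "y \<otimes> x = x [^] r \<otimes> y" by (simp add: xr)
  note exchange = conj_pow_exchange(1)[OF x y yx]
  define A where "A = range (\<lambda>i::nat. x [^] i)"
  define H where "H = A \<union> (\<lambda>a. a \<otimes> y) ` A"
  have H1: "x [^] i \<in> H" and H2: "x [^] i \<otimes> y \<in> H" for i :: nat by (auto simp: H_def A_def)
  have H_cases: "(\<exists>i::nat. h = x [^] i) \<or> (\<exists>i::nat. h = x [^] i \<otimes> y)" if "h \<in> H" for h
    using that unfolding H_def A_def by blast
  have closed: "h \<otimes> k \<in> H" if h: "h \<in> H" and k: "k \<in> H" for h k
  proof -
    have right_x: "h \<otimes> x [^] j \<in> H" for j :: nat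
    proof -
      consider i :: nat where "h = x [^] i" | i :: nat where "h = x [^] i \<otimes> y" using H_cases[OF h] by blast
      then show ?thesis
      proof cases
        case 1
        then show ?thesis using x H1 by (simp add: nat_pow_mult)
      next
        case 2
        then have "h \<otimes> x [^] j = (x [^] i \<otimes> x [^] (j * r)) \<otimes> y"
          using x y exchange[of j] by (simp add: m_assoc)
        then show ?thesis using x H2 by (simp add: nat_pow_mult)
      qed
    qed
    have right_y: "h' \<otimes> y \<in> H" if h': "h' \<in> H" for h'
    proof -
      consider i :: nat where "h' = x [^] i" | i :: nat where "h' = x [^] i \<otimes> y" using H_cases[OF h'] by blast
      then show ?thesis
      proof cases
        case 2
        then have "h' \<otimes> y = x [^] i \<otimes> x [^] M" using x y y2 by (simp add: m_assoc)
        then show ?thesis using x H1 by (simp add: nat_pow_mult)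
      qed (use H2 in simp)
    qed
    have hc: "h \<in> carrier G" using h x y by (auto simp: H_def A_def)
    consider j :: nat where "k = x [^] j" | j :: nat where "k = x [^] j \<otimes> y" using H_cases[OF k] by blast
    then show ?thesis
    proof cases
      case 2
      then have "h \<otimes> k = (h \<otimes> x [^] j) \<otimes> y" using hc x y by (simp add: m_assoc)
      then show ?thesis using right_y[OF right_x] by simp
    qed (use right_x in simp)
  qed
  have "(x [^] M \<otimes> y) \<otimes> y = x [^] M \<otimes> x [^] M" using x y y2 by (simp add: m_assoc)
  also have "\<dots> = \<one>" using xN x NM by (simp add: nat_pow_mult mult_2)
  finally have inv_y: "inv y = x [^] M \<otimes> y" using x y by (simp add: inv_equality)
  have "g \<in> H" if "g \<in> generate G {x, y}" for g
    using that
  proof induction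
    case one
    then show ?case using H1[of 0] by simp
  next
    case (incl h)
    then show ?case using H1[of 1] H2[of 0] x y by auto
  next
    case (inv h)
    then show ?case using H1[of r] H2[of M] by (auto simp: xr inv_y)
  next
    case (eng h1 h2)
    then show ?case using closed by blast
  qed
  then have H: "carrier G \<subseteq> H" using gen by blast
  have AX: "A = generate G {x}" unfolding A_def using generate_pow_on_finite_carrier[OF fin x] by auto
  have A_card: "card A = ord x" using generate_pow_card[OF x] AX by simp
  have A_fin: "finite A" unfolding AX using generate_incl[of "{x}"] x fin finite_subset by blast
  have "2 ^ n = card (carrier G)" using n by (simp add: order_def)
  also have "\<dots> \<le> card H" using H A_fin by (intro card_mono) (auto simp: H_def)
  also have "\<dots> \<le> card A + card ((\<lambda>a. a \<otimes> y) ` A)" unfolding H_def by (rule card_Un_le)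
  also have "\<dots> \<le> 2 * ord x" using card_image_le[OF A_fin, of "\<lambda>a. a \<otimes> y"] A_card by simp
  finally have "N \<le> ord x" using n by (cases n) (auto simp: N_def)
  \<comment> \<open>\<open>M\<close> is positive and smaller than \<open>N\<close>, hence smaller
    than \<open>ord x\<close>.\<close>
  then have "\<not> ord x dvd M" using NM M0 by (auto dest: dvd_imp_le)
  then have y2_ne: "y \<otimes> y \<noteq> \<one>" using pow_eq_id[OF x] y2 by simp
  have involution: "w \<in> generate G {x}" if w: "w \<in> carrier G" "ord w = 2" for w
  proof (rule ccontr)
    assume "w \<notin> generate G {x}"
    then have "\<nexists>i::nat. w = x [^] i" using nat_pow_in_generate_singleton[OF x] by blast
    then obtain i :: nat where i: "w = x [^] i \<otimes> y" using w(1) H H_cases by blast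
    have "w [^] (2::nat) = \<one>" using w pow_ord_eq_1 by metis
    then have "w \<otimes> w = \<one>" using w(1) by (simp add: numeral_2_eq_2)
    moreover have "w \<otimes> w = x [^] i \<otimes> (y \<otimes> x [^] i) \<otimes> y" unfolding i using x y by (simp add: m_assoc)
    moreover have "\<dots> = (x [^] i \<otimes> x [^] (i * r)) \<otimes> (y \<otimes> y)" unfolding exchange using x y by (simp add: m_assoc)
    moreover have "x [^] i \<otimes> x [^] (i * r) = x [^] (N * i)"
      using x by (simp add: nat_pow_mult algebra_simps flip: r1)
    moreover have "x [^] (N * i) = \<one>" using x xN by (metis nat_pow_one nat_pow_pow)
    ultimately show False using y2_ne y by simp
  qed
  show ?thesis
    using prime_order_cyclic_unique[OF fin x involution[OF u] u(2) involution[OF v] v(2)] two_is_prime_nat by blast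
qed

text \<open>Both structural possibilities are condensed into one condition on elements of order
  \<open>p\<close>, the one that also describes connectedness of the graph.\<close>

lemma p_group_cyclic_or_quaternion_iff:
  assumes "nilpotent_group G" and pG: "p_group p G"
  shows "cyclic_group G \<or> generalized_quaternion_2_group G \<longleftrightarrow>
    (\<forall>u\<in>carrier G. \<forall>v\<in>carrier G. ord u = p \<longrightarrow> ord v = p \<longrightarrow> u \<in> generate G {v})"
    (is "?L \<longleftrightarrow> ?R")
proof
  assume ?R
  then show ?L using p_group_unique_prime_order_subgroup[OF assms] by blast
next
  have p: "prime p" and fin: "finite (carrier G)" and "\<exists>n. order G = p ^ n"
    using pG unfolding p_group_def by auto
  then obtain k where k: "order G = p ^ k" by blast
  assume ?L
  then show ?R
  proof
    assume "cyclic_group G"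
    then obtain z where z: "z \<in> carrier G" "generate G {z} = carrier G" unfolding cyclic_group_iff_generate by blast
    then show ?R using prime_order_cyclic_unique[OF fin z(1)] p by metis
  next
    assume gq: "generalized_quaternion_2_group G"
    then obtain n where n: "n \<ge> 3" "order G = 2 ^ n" unfolding generalized_quaternion_2_group_def by blast
    then have "2 dvd p ^ k" using k by (metis dvd_power not_numeral_le_zero gr0I)
    then have "p = 2" using p prime_dvd_power primes_dvd_imp_eq two_is_prime_nat by blast
    then show ?R by (intro ballI impI generalized_quaternion_unique_involution[OF gq fin]) simp_all
  qed
qed

section \<open>Divisibility of orders, Cauchy's theorem and Sylow subgroups\<close>

lemma card_subgroup_dvd:
  assumes "subgroup H G" "subgroup K G" "H \<subseteq> K"
  shows "card H dvd card K"
proof -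
  interpret K: group "G\<lparr>carrier := K\<rparr>" using assms(2) by (rule subgroup_imp_group)
  have "subgroup H (G\<lparr>carrier := K\<rparr>)" using assms subgroup_incl by blast
  from K.lagrange[OF this] show ?thesis by (metis dvd_triv_right order_def partial_object.select_convs(1) partial_object.surjective partial_object.update_convs(1))
qed

lemma ord_dvd_card_subgroup:
  assumes "subgroup H G" "x \<in> H"
  shows "ord x dvd card H"
proof -
  have x: "x \<in> carrier G" by (rule subgroup.mem_carrier[OF assms])
  have "generate G {x} \<subseteq> H" using assms by (simp add: generate_subgroup_incl)
  then show ?thesis using card_subgroup_dvd[OF _ assms(1)] x generate_pow_card[OF x] by (simp add: generate_is_subgroup)
qed

lemma ord_dvd_ord_generator:
  assumes "x \<in> carrier G" "y \<in> generate G {x}"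
  shows "ord y dvd ord x"
  using ord_dvd_card_subgroup[OF generate_is_subgroup[of "{x}"] assms(2)] assms(1)
    generate_pow_card[OF assms(1)] by simp

text \<open>Cauchy's theorem: Sylow's existence theorem with exponent 1 gives a subgroup of order
  \<open>p\<close>, and each of its nontrivial elements has order \<open>p\<close>.\<close>

lemma prime_order_element:
  assumes "finite (carrier G)" "prime p" "p dvd order G"
  obtains x where "x \<in> carrier G" "ord x = p"
proof -
  obtain m where "order G = p ^ 1 * m" using assms(3) by auto
  then obtain H where H: "subgroup H G" "card H = p"
    using sylow_thm[OF assms(2) is_group, of 1 m] assms(1) by auto
  have "H \<noteq> {\<one>}" using H(2) prime_gt_1_nat[OF assms(2)] by auto
  then obtain x where x: "x \<in> H" "x \<noteq> \<one>" using subgroup.one_closed[OF H(1)] by blast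
  have xc: "x \<in> carrier G" by (rule subgroup.mem_carrier[OF H(1) x(1)])
  have "ord x dvd p" using ord_dvd_card_subgroup[OF H(1) x(1)] H(2) by simp
  then have "ord x = p" using x(2) ord_eq_1[OF xc] assms(2) by (auto simp: prime_nat_iff)
  with xc that show thesis by blast
qed

lemma sylow_subgroup_exists:
  assumes "finite (carrier G)" "prime p"
  obtains P where "sylow_subgroup p P G"
proof -
  have "order G = p ^ multiplicity p (order G) * (order G div p ^ multiplicity p (order G))"
    by (simp add: multiplicity_dvd)
  from sylow_thm[OF assms(2) is_group this assms(1)] assms(2) that
  show thesis unfolding sylow_subgroup_def by blast
qed

text \<open>
  The normalizer of \<open>P\<close> contains \<open>P\<close> and, since elements of coprime orders commute, a Sylow subgroup
  for every other prime; hence it has full order.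
\<close>

lemma nilpotent_sylow_normal:
  assumes nil: "nilpotent_group G" and fin: "finite (carrier G)" and P: "sylow_subgroup p P G"
  shows "P \<lhd> G"
proof -
  have p: "prime p" and P_sub: "subgroup P G" and P_card: "card P = p ^ multiplicity p (order G)"
    using P unfolding sylow_subgroup_def by auto
  interpret P: subgroup P G by (rule P_sub)
  \<comment> \<open>The normalizer of \<open>P\<close>, stated as an equivalence so that replacing
    \<open>y\<close> by \<open>g^-1 y g\<close> gives closure under inverses.\<close>
  define N where "N = {g \<in> carrier G. \<forall>y\<in>carrier G. g \<otimes> y \<otimes> inv g \<in> P \<longleftrightarrow> y \<in> P}"
  have N: "subgroup N G"
  proof (rule subgroupI)
    have "\<one> \<in> N" by (simp add: N_def)
    then show "N \<noteq> {}" by blast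
    fix g assume "g \<in> N"
    then have g: "g \<in> carrier G" "\<And>y. y \<in> carrier G \<Longrightarrow> g \<otimes> y \<otimes> inv g \<in> P \<longleftrightarrow> y \<in> P" by (auto simp: N_def)
    have "inv g \<otimes> y \<otimes> inv (inv g) \<in> P \<longleftrightarrow> y \<in> P" if y: "y \<in> carrier G" for y
      using g(2)[of "inv g \<otimes> y \<otimes> g"] g(1) y by (simp add: group_word_simps)
    then show "inv g \<in> N" using g(1) by (simp add: N_def)
    fix h assume "h \<in> N"
    then have h: "h \<in> carrier G" "\<And>y. y \<in> carrier G \<Longrightarrow> h \<otimes> y \<otimes> inv h \<in> P \<longleftrightarrow> y \<in> P" by (auto simp: N_def)
    have "g \<otimes> h \<otimes> y \<otimes> inv (g \<otimes> h) \<in> P \<longleftrightarrow> y \<in> P" if y: "y \<in> carrier G" for y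
    proof -
      have "g \<otimes> h \<otimes> y \<otimes> inv (g \<otimes> h) = g \<otimes> (h \<otimes> y \<otimes> inv h) \<otimes> inv g" using g(1) h(1) y by (simp add: group_word_simps)
      then show ?thesis using g(2)[of "h \<otimes> y \<otimes> inv h"] h g(1) y by simp
    qed
    then show "g \<otimes> h \<in> N" using g(1) h(1) by (simp add: N_def)
  qed (auto simp: N_def)
  have PN: "P \<subseteq> N"
  proof
    fix g assume g: "g \<in> P"
    have "y \<in> P" if y: "y \<in> carrier G" and "g \<otimes> y \<otimes> inv g \<in> P" for y
    proof -
      have "inv g \<otimes> (g \<otimes> y \<otimes> inv g) \<otimes> g \<in> P" using g that(2) by blast
      then show ?thesis using g y P.mem_carrier by (simp add: group_word_simps)
    qed
    moreover have "g \<otimes> y \<otimes> inv g \<in> P" if "y \<in> P" for y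
      using g that by (intro P.m_closed P.m_inv_closed)
    ultimately have "\<forall>y\<in>carrier G. g \<otimes> y \<otimes> inv g \<in> P \<longleftrightarrow> y \<in> P" by blast
    then show "g \<in> N" using P.mem_carrier[OF g] by (simp add: N_def)
  qed
  have coprime_N: "x \<in> N" if x: "x \<in> carrier G" and cop: "coprime (ord x) p" for x
  proof -
    have comm: "x \<otimes> y = y \<otimes> x" if y: "y \<in> P" for y
    proof (rule nilpotent_coprime_orders_commute[OF nil x])
      have "ord y dvd p ^ multiplicity p (order G)" using ord_dvd_card_subgroup[OF P_sub y] P_card by simp
      moreover have "coprime (ord x) (p ^ multiplicity p (order G))" using cop by simp
      ultimately show "coprime (ord x) (ord y)" using coprime_divisors dvd_refl by blast
    qed (use y in auto)
    have "x \<otimes> y \<otimes> inv x \<in> P \<longleftrightarrow> y \<in> P" if y: "y \<in> carrier G" for y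
    proof
      assume "y \<in> P"
      then show "x \<otimes> y \<otimes> inv x \<in> P" using comm x y by (simp add: m_assoc)
    next
      assume z: "x \<otimes> y \<otimes> inv x \<in> P"
      \<comment> \<open>The conjugate of \<open>y\<close> lies in \<open>P\<close> and so commutes
        with \<open>x\<close>; undoing the conjugation shows that it is \<open>y\<close>
        itself.\<close>
      have "x \<otimes> (x \<otimes> y \<otimes> inv x) = x \<otimes> y" unfolding comm[OF z] using x y by (simp add: group_word_simps)
      then have "x \<otimes> y \<otimes> inv x = y" using x y by simp
      with z show "y \<in> P" by simp
    qed
    then show ?thesis using x by (simp add: N_def)
  qed
  \<comment> \<open>Prime by prime: for each \<open>q\<close> the subgroup \<open>N\<close> contains
    a Sylow \<open>q\<close>-subgroup.\<close>
  have "order G dvd card N"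
  proof (rule multiplicity_le_imp_dvd)
    show "order G \<noteq> 0" using fin order_gt_0_iff_finite by simp
    fix q :: nat assume q: "prime q"
    obtain Q where Q: "sylow_subgroup q Q G" using sylow_subgroup_exists[OF fin q] .
    then have Q_sub: "subgroup Q G" and Q_card: "card Q = q ^ multiplicity q (order G)"
      unfolding sylow_subgroup_def by auto
    have "q ^ multiplicity q (order G) dvd card N"
    proof (cases "q = p")
      case True
      then show ?thesis using card_subgroup_dvd[OF P_sub N PN] P_card by simp
    next
      case False
      have "Q \<subseteq> N"
      proof
        fix x assume x: "x \<in> Q"
        have "ord x dvd q ^ multiplicity q (order G)" using ord_dvd_card_subgroup[OF Q_sub x] Q_card by simp
        moreover have "coprime (q ^ multiplicity q (order G)) p" using False p q by (simp add: primes_coprime)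
        ultimately have "coprime (ord x) p" using coprime_divisors dvd_refl by blast
        then show "x \<in> N" using coprime_N subgroup.mem_carrier[OF Q_sub x] by blast
      qed
      then show ?thesis using card_subgroup_dvd[OF Q_sub N] Q_card by simp
    qed
    moreover have "card N \<noteq> 0" using N fin by (metis card_0_eq finite_subset subgroup.subset subgroup.one_closed empty_iff)
    ultimately show "multiplicity q (order G) \<le> multiplicity q (card N)"
      using q by (intro multiplicity_geI) auto
  qed
  moreover have "card N > 0" using N fin by (metis card_gt_0_iff finite_subset subgroup.subset subgroup.one_closed empty_iff)
  ultimately have "card (carrier G) \<le> card N" by (simp add: dvd_imp_le order_def)
  then have "N = carrier G" using fin N subgroup.subset by (metis card_seteq)
  then have "g \<otimes> y \<otimes> inv g \<in> P" if "g \<in> carrier G" "y \<in> P" for g y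
    using that P.mem_carrier[OF that(2)] unfolding N_def by blast
  then show ?thesis unfolding normal_inv_iff using P_sub by blast
qed

text \<open>\<open>G Mod P\<close> has order prime to \<open>p\<close>, so the image of
  \<open>x\<close> there, whose order divides \<open>p\<close>, is trivial.\<close>

lemma nilpotent_prime_order_in_sylow:
  assumes nil: "nilpotent_group G" and fin: "finite (carrier G)" and P: "sylow_subgroup p P G"
    and x: "x \<in> carrier G" "ord x = p"
  shows "x \<in> P"
proof -
  have p: "prime p" and P_card: "card P = p ^ multiplicity p (order G)"
    using P unfolding sylow_subgroup_def by auto
  interpret P: normal P G by (rule nilpotent_sylow_normal[OF nil fin P])
  interpret Q: group "G Mod P" by (rule P.factorgroup_is_group)
  interpret h: group_hom G "G Mod P" "(#>) P"
    by unfold_locales (rule P.r_coset_hom_Mod)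
  have index: "order (G Mod P) * card P = order G"
    using lagrange[OF P.subgroup_axioms] by (simp add: order_def FactGroup_def)
  have "\<not> p dvd order (G Mod P)"
  proof
    assume "p dvd order (G Mod P)"
    then have "p * p ^ multiplicity p (order G) dvd order G"
      using index P_card by (metis mult_dvd_mono dvd_refl)
    then have "p ^ Suc (multiplicity p (order G)) dvd order G" by simp
    moreover have "order G \<noteq> 0" using fin order_gt_0_iff_finite by simp
    ultimately have "Suc (multiplicity p (order G)) \<le> multiplicity p (order G)"
      using p by (subst (asm) power_dvd_iff_le_multiplicity) auto
    then show False by simp
  qed
  then have cop: "coprime p (order (G Mod P))" using p by (simp add: prime_imp_coprime)
  have "(P #> x) [^]\<^bsub>G Mod P\<^esub> p = P #> (x [^] p)" using x by (simp only: h.hom_nat_pow)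
  also have "\<dots> = \<one>\<^bsub>G Mod P\<^esub>" using x by (metis h.hom_one pow_ord_eq_1)
  finally have "Q.ord (P #> x) dvd p" using Q.pow_eq_id h.hom_closed[OF x(1)] by blast
  moreover have "Q.ord (P #> x) dvd order (G Mod P)" using Q.ord_dvd_group_order h.hom_closed[OF x(1)] by blast
  ultimately have "Q.ord (P #> x) = 1" using cop coprime_common_divisor_nat by blast
  then have "P #> x = \<one>\<^bsub>G Mod P\<^esub>" using Q.ord_eq_1 h.hom_closed[OF x(1)] by blast
  then have "P #> x = P" by simp
  then show ?thesis using coset_join1 P.subset x(1) P.subgroup_axioms by blast
qed

lemma ord_consistent:
  "group.ord (G\<lparr>carrier := H\<rparr>) x = ord x" if "subgroup H G"
  unfolding ord_def group.ord_def[OF subgroup_imp_group[OF that]] by (simp flip: nat_pow_consistent)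

lemma sylow_p_group:
  assumes "finite (carrier G)" "sylow_subgroup p P G"
  shows "p_group p (G\<lparr>carrier := P\<rparr>)"
  using assms unfolding sylow_subgroup_def p_group_def
  by (auto simp: order_def subgroup_imp_group intro: finite_subset[OF subgroup.subset])

text \<open>All elements of order \<open>p\<close> lie in \<open>P\<close>, and orders and generated
  subgroups are the same in \<open>P\<close> and in \<open>G\<close>; so the criterion for the
  \<open>p\<close>-group \<open>P\<close> can be read in \<open>G\<close>.\<close>

lemma nilpotent_sylow_cyclic_or_quaternion_iff:
  assumes nil: "nilpotent_group G" and fin: "finite (carrier G)" and P: "sylow_subgroup p P G"
  shows "cyclic_group (G\<lparr>carrier := P\<rparr>) \<or> generalized_quaternion_2_group (G\<lparr>carrier := P\<rparr>) \<longleftrightarrow>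
    (\<forall>u\<in>carrier G. \<forall>v\<in>carrier G. ord u = p \<longrightarrow> ord v = p \<longrightarrow> u \<in> generate G {v})"
proof -
  have P_sub: "subgroup P G" using P unfolding sylow_subgroup_def by auto
  interpret P: group "G\<lparr>carrier := P\<rparr>" using P_sub by (rule subgroup_imp_group)
  have gen: "generate (G\<lparr>carrier := P\<rparr>) {v} = generate G {v}" if "v \<in> P" for v
    using that by (intro generate_consistent[OF _ P_sub]) simp
  have "cyclic_group (G\<lparr>carrier := P\<rparr>) \<or> generalized_quaternion_2_group (G\<lparr>carrier := P\<rparr>) \<longleftrightarrow>
    (\<forall>u\<in>P. \<forall>v\<in>P. ord u = p \<longrightarrow> ord v = p \<longrightarrow> u \<in> generate G {v})"
    using P.p_group_cyclic_or_quaternion_iff[OF nilpotent_subgroup[OF nil P_sub] sylow_p_group[OF fin P]]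
    by (simp add: ord_consistent[OF P_sub] gen)
  also have "\<dots> \<longleftrightarrow> (\<forall>u\<in>carrier G. \<forall>v\<in>carrier G. ord u = p \<longrightarrow> ord v = p \<longrightarrow> u \<in> generate G {v})"
    using nilpotent_prime_order_in_sylow[OF nil fin P] subgroup.mem_carrier[OF P_sub] by blast
  finally show ?thesis .
qed

lemma not_p_group_two_primes:
  assumes fin: "finite (carrier G)" and "\<nexists>p. p_group p G"
  obtains p q where "prime p" "prime q" "p \<noteq> q" "p dvd order G" "q dvd order G"
proof -
  have no_power: "order G \<noteq> p ^ n" if "prime p" for p n
    using assms that is_group unfolding p_group_def by blast
  \<comment> \<open>The trivial group is a \<open>p\<close>-group with exponent 0, here for
    \<open>p = 2\<close>, and is thereby excluded.\<close>
  have "order G \<noteq> 1" using no_power[OF two_is_prime_nat, of 0] by simp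
  then obtain p where p: "prime p" "p dvd order G" using prime_factor_nat by blast
  have "order G \<noteq> 0" using fin order_gt_0_iff_finite by simp
  then obtain m where m: "order G = p ^ multiplicity p (order G) * m" "\<not> p dvd m"
    using multiplicity_decompose' p(1) by (metis not_prime_unit)
  have "m \<noteq> 1" using m(1) no_power[OF p(1)] by auto
  then obtain q where q: "prime q" "q dvd m" using prime_factor_nat by blast
  have "q dvd order G" using q(2) m(1) by (metis dvd_mult)
  moreover have "p \<noteq> q" using q(2) m(2) by blast
  ultimately show thesis using that p q by blast
qed

end

section \<open>Distances and components of the power graph\<close>

text \<open>For finite \<open>G\<close> this is adjacency or equality of vertices, the natural
  powers of \<open>x\<close> being exactly \<open>generate G {x}\<close>. The reflexive form makes
  the \<open>n\<close>-th relation power, for positive \<open>n\<close>, describe distance at most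
  \<open>n\<close>.\<close>

definition power_rel :: "('a, 'b) monoid_scheme \<Rightarrow> ('a \<times> 'a) set" where
  "power_rel G = {(x, y). x \<in> carrier G - {\<one>\<^bsub>G\<^esub>} \<and> y \<in> carrier G - {\<one>\<^bsub>G\<^esub>} \<and>
     (x \<in> generate G {y} \<or> y \<in> generate G {x})}"

lemma verts_proper_power_graph [simp]:
  "verts (proper_power_graph G) = carrier G - {\<one>\<^bsub>G\<^esub>}"
  by (simp add: proper_power_graph_def)

text \<open>A reflexive step pads a path to greater length. \<open>R ^^ 0\<close> is left out
  because it relates also points outside the domain of \<open>R\<close>.\<close>

lemma relpow_mono_refl:
  assumes "\<And>x. x \<in> Domain R \<Longrightarrow> (x, x) \<in> R" "m \<le> n" "m > 0"
  shows "R ^^ m \<subseteq> R ^^ n"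
  using assms(2)
proof (induction n rule: dec_induct)
  case (step n)
  have "R ^^ n \<subseteq> R O R ^^ n"
  proof (rule subrelI)
    fix x y assume xy: "(x, y) \<in> R ^^ n"
    have "n > 0" using step assms(3) by simp
    then have "x \<in> Domain R" using xy by (metis Domain.DomainI gr0_conv_Suc relpow_Suc_E2)
    with assms(1) xy show "(x, y) \<in> R O R ^^ n" by blast
  qed
  then show ?case using step by (auto simp: relpow_commute)
qed simp

locale finite_group = group +
  assumes fin: "finite (carrier G)"
begin

section \<open>Walks, distances and connectedness through powers of a relation\<close>

abbreviation "V \<equiv> carrier G - {\<one>}"
abbreviation "\<Gamma> \<equiv> proper_power_graph G"
abbreviation "E \<equiv> power_rel G"

sublocale \<Gamma>: graph \<Gamma>
  by (rule graph_proper_power_graph[OF fin])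

lemma arcs_proper_power_graph:
  "(x, y) \<in> arcs \<Gamma> \<longleftrightarrow> (x, y) \<in> E \<and> x \<noteq> y"
proof -
  have gen: "(\<exists>k::nat. u = v [^] k) \<longleftrightarrow> u \<in> generate G {v}" if "v \<in> carrier G" for u v
    using generate_pow_on_finite_carrier[OF fin that] by auto
  show ?thesis
    unfolding proper_power_graph_def power_rel_def with_proj_simps pair_pre_digraph.simps
    by (auto simp: gen cong: conj_cong)
qed

lemma tail_head_proper_power_graph [simp]: "tail \<Gamma> = fst" "head \<Gamma> = snd"
  by (simp_all add: proper_power_graph_def)

lemma power_rel_refl: "x \<in> V \<Longrightarrow> (x, x) \<in> E"
  by (simp add: power_rel_def self_in_generate_singleton)

lemma power_rel_sym: "(x, y) \<in> E \<Longrightarrow> (y, x) \<in> E"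
  by (auto simp: power_rel_def)

lemma relpow_power_rel_mono: "m \<le> n \<Longrightarrow> m > 0 \<Longrightarrow> E ^^ m \<subseteq> E ^^ n"
  by (rule relpow_mono_refl) (auto simp: power_rel_def self_in_generate_singleton)

text \<open>Reflexive steps correspond to no arc and are skipped, so the walk may be shorter than
  \<open>n\<close>.\<close>

lemma relpow_imp_awalk:
  assumes "(x, y) \<in> E ^^ n" "x \<in> V"
  shows "\<exists>w. \<Gamma>.awalk x w y \<and> length w \<le> n"
  using assms
proof (induction n arbitrary: x)
  case 0
  then show ?case by (intro exI[of _ "[]"]) (simp add: \<Gamma>.awalk_Nil_iff)
next
  case (Suc n)
  from Suc.prems(1) obtain z where z: "(x, z) \<in> E" "(z, y) \<in> E ^^ n" by (rule relpow_Suc_E2)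
  then have "z \<in> V" by (auto simp: power_rel_def)
  with Suc.IH z(2) obtain w where w: "\<Gamma>.awalk z w y" "length w \<le> n" by blast
  show ?case
  proof (cases "x = z")
    case True
    with w show ?thesis by (intro exI[of _ w]) simp
  next
    case False
    then have "(x, z) \<in> arcs \<Gamma>" using z(1) arcs_proper_power_graph by blast
    with w show ?thesis by (intro exI[of _ "(x, z) # w"]) (simp add: \<Gamma>.awalk_Cons_iff)
  qed
qed

lemma awalk_imp_relpow:
  assumes "\<Gamma>.awalk x w y"
  shows "(x, y) \<in> E ^^ length w"
  using assms
proof (induction w arbitrary: x)
  case Nil
  then show ?case by (simp add: \<Gamma>.awalk_Nil_iff)
next
  case (Cons e w)
  then have e: "e \<in> arcs \<Gamma>" "x = fst e" "\<Gamma>.awalk (snd e) w y" by (simp_all add: \<Gamma>.awalk_Cons_iff)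
  then have "(x, snd e) \<in> E" using arcs_proper_power_graph[of "fst e" "snd e"] by simp
  then show ?case using Cons.IH[OF e(3)] relpow_Suc_I2[of x "snd e" E y "length w"] by simp
qed

lemma awalk_cost_one: "\<Gamma>.awalk_cost (\<lambda>_. 1) w = real (length w)"
  by (induction w) simp_all

lemma graph_dist_eq: "graph_dist \<Gamma> x y = (INF w\<in>{w. \<Gamma>.awalk x w y}. ereal (real (length w)))"
  unfolding graph_dist_def \<Gamma>.\<mu>_def awalk_cost_one ..

lemma graph_dist_le:
  assumes "(x, y) \<in> E ^^ n" "x \<in> V"
  shows "graph_dist \<Gamma> x y \<le> ereal (real n)"
proof -
  obtain w where w: "\<Gamma>.awalk x w y" "length w \<le> n" using relpow_imp_awalk[OF assms] by blast
  have "graph_dist \<Gamma> x y \<le> ereal (real (length w))"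
    unfolding graph_dist_eq using w(1) by (intro INF_lower) simp
  also have "\<dots> \<le> ereal (real n)" using w(2) by simp
  finally show ?thesis .
qed

lemma graph_dist_ge:
  assumes "(x, y) \<notin> E ^^ n" "n > 0" "x \<in> V"
  shows "ereal (real (Suc n)) \<le> graph_dist \<Gamma> x y"
  unfolding graph_dist_eq
proof (rule INF_greatest)
  fix w assume "w \<in> {w. \<Gamma>.awalk x w y}"
  then have w: "(x, y) \<in> E ^^ length w" using awalk_imp_relpow by simp
  have "\<not> length w \<le> n"
  proof
    assume le: "length w \<le> n"
    show False
    proof (cases "length w = 0")
      case True
      then have "(x, y) \<in> E ^^ 1" using w power_rel_refl[OF assms(3)] by auto
      then show False using relpow_power_rel_mono[of 1 n] assms(1,2) by auto
    next
      case False
      then show False using relpow_power_rel_mono[of "length w" n] le assms(1) w by auto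
    qed
  qed
  then show "ereal (real (Suc n)) \<le> ereal (real (length w))" by simp
qed

lemma reachable_iff: "x \<rightarrow>\<^sup>*\<^bsub>\<Gamma>\<^esub> y \<longleftrightarrow> x \<in> V \<and> (x, y) \<in> E\<^sup>*"
proof
  assume "x \<rightarrow>\<^sup>*\<^bsub>\<Gamma>\<^esub> y"
  then obtain w where w: "\<Gamma>.awalk x w y" using \<Gamma>.reachable_awalk by blast
  then show "x \<in> V \<and> (x, y) \<in> E\<^sup>*"
    using awalk_imp_relpow[OF w] \<Gamma>.awalk_hd_in_verts[OF w] relpow_imp_rtrancl by auto
next
  assume *: "x \<in> V \<and> (x, y) \<in> E\<^sup>*"
  then obtain n where "(x, y) \<in> E ^^ n" using rtrancl_imp_relpow by blast
  with * show "x \<rightarrow>\<^sup>*\<^bsub>\<Gamma>\<^esub> y" using relpow_imp_awalk \<Gamma>.reachable_awalk by blast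
qed

text \<open>The arcs are symmetric, so their symmetric closure has the same reachability; for an
  empty vertex set both sides are true.\<close>

lemma graph_connected_iff: "graph_connected \<Gamma> \<longleftrightarrow> (\<forall>x\<in>V. \<forall>y\<in>V. (x, y) \<in> E\<^sup>*)"
proof -
  have "Digraph_Component.connected \<Gamma> \<longleftrightarrow> V \<noteq> {} \<and> (\<forall>x\<in>V. \<forall>y\<in>V. x \<rightarrow>\<^sup>*\<^bsub>\<Gamma>\<^esub> y)"
    unfolding connected_def strongly_connected_def \<Gamma>.reachable_mk_symmetric_eq[OF \<Gamma>.sym_arcs]
    by (simp add: mk_symmetric_def)
  then show ?thesis
    unfolding graph_connected_def reachable_iff by auto
qed

text \<open>The first premise bounds all distances by \<open>n + 1\<close>, and the pair
  \<open>u\<close>, \<open>v\<close> attains the bound. It is applied with \<open>n = 1\<close> and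
  \<open>n = 3\<close>.\<close>

lemma graph_diam_eqI:
  assumes le: "\<And>x y. x \<in> V \<Longrightarrow> y \<in> V \<Longrightarrow> (x, y) \<in> E ^^ Suc n"
    and uv: "u \<in> V" "v \<in> V" "(u, v) \<notin> E ^^ n" and n: "n > 0"
  shows "graph_connected \<Gamma>" and "graph_diam \<Gamma> = ereal (real (Suc n))"
proof -
  show conn: "graph_connected \<Gamma>"
    unfolding graph_connected_iff using le relpow_imp_rtrancl by blast
  have "(SUP x\<in>V. SUP y\<in>V. graph_dist \<Gamma> x y) \<le> ereal (real (Suc n))"
    using le by (intro SUP_least graph_dist_le)
  moreover have "ereal (real (Suc n)) \<le> (SUP x\<in>V. SUP y\<in>V. graph_dist \<Gamma> x y)"
    using graph_dist_ge[OF uv(3) n uv(1)] uv by (intro SUP_upper2[OF uv(1)] SUP_upper2[OF uv(2)])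
  ultimately show "graph_diam \<Gamma> = ereal (real (Suc n))"
    unfolding graph_diam_def using conn by simp
qed

section \<open>Elements of prime order and commuting elements of coprime orders\<close>

lemma prime_order_root:
  assumes "x \<in> carrier G" "p dvd ord x" "prime p"
  obtains h where "h \<in> generate G {x}" "h \<in> carrier G" "ord h = p"
proof -
  obtain q where q: "ord x = p * q" using assms(2) by blast
  have "q \<noteq> 0" using q ord_ge_1[OF fin assms(1)] by auto
  then have "ord (x [^] q) = p" using ord_pow[OF assms(1), of q] q by simp
  then show thesis using that[of "x [^] q"] nat_pow_in_generate_singleton assms(1) by simp
qed

lemma prime_order_nontrivial: "x \<in> carrier G \<Longrightarrow> prime (ord x) \<Longrightarrow> x \<in> V"
  using ord_id not_prime_1 by fastforce

lemma generate_eq_of_prime_order: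
  assumes "x \<in> carrier G" "prime (ord x)" "y \<in> generate G {x}" "y \<noteq> \<one>"
  shows "x \<in> generate G {y}"
proof -
  have y: "y \<in> carrier G" using generate_singleton_in_carrier assms(1,3) by blast
  have "ord y dvd ord x" by (rule ord_dvd_ord_generator[OF assms(1,3)])
  then have "ord y = ord x" using assms(2,4) ord_eq_1[OF y] by (auto simp: prime_nat_iff)
  then show ?thesis
    using prime_order_cyclic_unique[OF fin assms(1) self_in_generate_singleton refl assms(3)] assms(2) by simp
qed

lemma power_rel_to_root:
  "x \<in> carrier G \<Longrightarrow> h \<in> generate G {x} \<Longrightarrow> prime (ord h) \<Longrightarrow> (x, h) \<in> E"
  using prime_order_nontrivial[of h] generate_singleton_in_carrier[of x h] generate_one
  by (auto simp: power_rel_def)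

lemma exists_prime_dvd_ord: "x \<in> V \<Longrightarrow> \<exists>p. prime p \<and> p dvd ord x"
  using prime_factor_nat[of "ord x"] ord_eq_1[of x] by auto

text \<open>An exponent that is 0 modulo \<open>ord y\<close> and 1 modulo \<open>ord x\<close>
  kills \<open>y\<close> and keeps \<open>x\<close>.\<close>

lemma coprime_commuting_in_generate:
  assumes "x \<in> carrier G" "y \<in> carrier G" "x \<otimes> y = y \<otimes> x" "coprime (ord x) (ord y)"
  shows "x \<in> generate G {x \<otimes> y}"
proof -
  obtain t where t: "[ord y * t = 1] (mod ord x)"
    using cong_solve_coprime_nat[of "ord y" "ord x"] assms(4) by (auto simp: coprime_commute)
  have "(x \<otimes> y) [^] (ord y * t) = x [^] (ord y * t) \<otimes> y [^] (ord y * t)"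
    by (rule pow_mult_distrib[OF assms(3,1,2)])
  also have "y [^] (ord y * t) = \<one>" using assms(2) by (simp add: pow_eq_id)
  also have "x [^] (ord y * t) = x [^] (1::nat)" using t nat_pow_eq_iff_cong[OF assms(1)] by blast
  finally have "(x \<otimes> y) [^] (ord y * t) = x" using assms(1) by simp
  then show ?thesis using nat_pow_in_generate_singleton[of "x \<otimes> y" "ord y * t"] assms by simp
qed

text \<open>The product \<open>x \<otimes> y\<close> is the midpoint: both factors are powers of it,
  which also shows that it is not \<open>\<one>\<close>.\<close>

lemma coprime_commuting_relpow:
  assumes x: "x \<in> V" and y: "y \<in> V" and comm: "x \<otimes> y = y \<otimes> x" and cop: "coprime (ord x) (ord y)"
  shows "(x, y) \<in> E ^^ 2"
proof -
  have xg: "x \<in> generate G {x \<otimes> y}" using coprime_commuting_in_generate assms by blast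
  have yg: "y \<in> generate G {x \<otimes> y}"
    using coprime_commuting_in_generate[of y x] assms by (simp add: coprime_commute)
  have "x \<otimes> y \<noteq> \<one>" using xg x by (auto simp: generate_one)
  then have "(x, x \<otimes> y) \<in> E" "(x \<otimes> y, y) \<in> E" using xg yg x y by (auto simp: power_rel_def)
  then show ?thesis by (auto simp: numeral_2_eq_2)
qed

section \<open>Connectedness and components for p-groups\<close>

lemma p_group_prime_dvd_ord:
  assumes pG: "p_group p G" and x: "x \<in> V"
  shows "p dvd ord x"
proof -
  have p: "prime p" and "\<exists>n. order G = p ^ n" using pG unfolding p_group_def by auto
  then obtain n where n: "order G = p ^ n" by blast
  obtain q where q: "prime q" "q dvd ord x" using exists_prime_dvd_ord[OF x] by blast
  have "ord x dvd p ^ n" using ord_dvd_group_order[of x] x n by simp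
  then have "q dvd p" using q prime_dvd_power by (metis dvd_trans)
  then show ?thesis using q p primes_dvd_imp_eq by blast
qed

text \<open>If \<open>x\<close> is a power of \<open>y\<close>, the inclusion of cyclic subgroups
  suffices. If \<open>y\<close> is a power of \<open>x\<close>, then
  \<open>\<langle>y\<rangle>\<close> has some subgroup of order \<open>p\<close>, and it is the only
  one in \<open>\<langle>x\<rangle>\<close>, hence generated by \<open>h\<close>.\<close>

lemma power_rel_imp_same_prime_subgroup:
  assumes xy: "(x, y) \<in> E" and h: "h \<in> generate G {x}" "prime (ord h)"
    and pG: "p_group p G"
  shows "h \<in> generate G {y}"
proof -
  have p: "prime p" using pG unfolding p_group_def by blast
  note ord_p = p_group_prime_dvd_ord[OF pG]
  have x: "x \<in> V" and y: "y \<in> V" using xy by (auto simp: power_rel_def)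
  have hc: "h \<in> carrier G" using h(1) x generate_singleton_in_carrier by blast
  from ord_p[OF prime_order_nontrivial[OF hc h(2)]] have ord_h: "ord h = p"
    using h(2) p primes_dvd_imp_eq by metis
  show ?thesis
  proof (cases "x \<in> generate G {y}")
    case True
    then show ?thesis using generate_singleton_mono[of y x] y h(1) by blast
  next
    case False
    then have "y \<in> generate G {x}" using xy by (auto simp: power_rel_def)
    moreover obtain k where k: "k \<in> generate G {y}" "k \<in> carrier G" "ord k = p"
      using prime_order_root[OF _ ord_p[OF y] p] y by blast
    ultimately have "k \<in> generate G {x}" using generate_singleton_mono[of x y] x by blast
    then have "h \<in> generate G {k}"
      using prime_order_cyclic_unique[OF fin _ h(1) ord_h _ k(3) p] x by blast
    then show ?thesis using generate_singleton_mono[of y k] k(1) y by blast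
  qed
qed

lemma rtrancl_power_rel_imp_same_prime_subgroup:
  assumes "(x, y) \<in> E\<^sup>*" "h \<in> generate G {x}" "prime (ord h)" "p_group p G"
  shows "h \<in> generate G {y}"
  using assms by (induction rule: rtrancl_induct) (auto intro: power_rel_imp_same_prime_subgroup)

lemma p_group_prime_order_root:
  assumes pG: "p_group p G" and x: "x \<in> V"
  obtains h where "h \<in> generate G {x}" "h \<in> V" "ord h = p" "(x, h) \<in> E"
proof -
  have p: "prime p" using pG unfolding p_group_def by blast
  obtain h where h: "h \<in> generate G {x}" "h \<in> carrier G" "ord h = p"
    using prime_order_root[OF _ p_group_prime_dvd_ord[OF pG x] p] x by blast
  then show thesis
    using that prime_order_nontrivial[of h] power_rel_to_root[of x h] p x by blast
qed

text \<open>Walks preserve the subgroup of order \<open>p\<close> below a vertex, so connectedness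
  leaves at most one. Conversely each vertex is related to an element of order \<open>p\<close>
  below it, and by uniqueness all of these are related to each other.\<close>

lemma p_group_connected_iff:
  assumes pG: "p_group p G"
  shows "graph_connected \<Gamma> \<longleftrightarrow>
    (\<forall>u\<in>carrier G. \<forall>v\<in>carrier G. ord u = p \<longrightarrow> ord v = p \<longrightarrow> u \<in> generate G {v})"
proof -
  have p: "prime p" using pG unfolding p_group_def by blast
  show ?thesis unfolding graph_connected_iff
  proof (intro iffI ballI impI)
    fix u v assume "\<forall>x\<in>V. \<forall>y\<in>V. (x, y) \<in> E\<^sup>*" and u: "u \<in> carrier G" "ord u = p" and v: "v \<in> carrier G" "ord v = p"
    then have "(u, v) \<in> E\<^sup>*" using prime_order_nontrivial p by simp
    then show "u \<in> generate G {v}"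
      using rtrancl_power_rel_imp_same_prime_subgroup[OF _ self_in_generate_singleton _ pG] u p by simp
  next
    fix x y
    assume uniq: "\<forall>u\<in>carrier G. \<forall>v\<in>carrier G. ord u = p \<longrightarrow> ord v = p \<longrightarrow> u \<in> generate G {v}"
      and x: "x \<in> V" and y: "y \<in> V"
    obtain h where h: "h \<in> V" "ord h = p" "(x, h) \<in> E" using p_group_prime_order_root[OF pG x] by blast
    obtain k where k: "k \<in> V" "ord k = p" "(y, k) \<in> E" using p_group_prime_order_root[OF pG y] by blast
    have "(h, k) \<in> E" using uniq h k by (simp add: power_rel_def)
    with h(3) power_rel_sym[OF k(3)] show "(x, y) \<in> E\<^sup>*" by (meson converse_rtrancl_into_rtrancl r_into_rtrancl)
  qed
qed

lemma subgroup_prime_card_generate: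
  assumes H: "subgroup H G" "card H = p" and p: "prime p"
  obtains h where "h \<in> V" "ord h = p" "H = generate G {h}"
proof -
  have "H \<noteq> {\<one>}" using H(2) prime_gt_1_nat[OF p] by auto
  then obtain h where h: "h \<in> H" "h \<noteq> \<one>" using subgroup.one_closed[OF H(1)] by blast
  have hc: "h \<in> carrier G" by (rule subgroup.mem_carrier[OF H(1) h(1)])
  have "ord h dvd p" using ord_dvd_card_subgroup[OF H(1) h(1)] H(2) by simp
  then have ord_h: "ord h = p" using h(2) ord_eq_1[OF hc] p by (auto simp: prime_nat_iff)
  have "finite H" using finite_subset[OF subgroup.subset[OF H(1)] fin] .
  moreover have "generate G {h} \<subseteq> H" using H(1) h(1) by (simp add: generate_subgroup_incl)
  ultimately have "generate G {h} = H"
    using generate_pow_card[OF hc] ord_h H(2) by (simp add: card_subset_eq)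
  with that[of h] h(2) hc ord_h show thesis by simp
qed

text \<open>The component that belongs to \<open>H\<close> consists of the vertices whose cyclic
  subgroup contains \<open>H\<close>. A generator of \<open>H\<close> is related to all of them, and
  walks cannot leave the set.\<close>

lemma p_group_components:
  assumes pG: "p_group p G"
  shows "card (pre_digraph.sccs \<Gamma>) = card {H. subgroup H G \<and> card H = p}"
proof -
  have p: "prime p" using pG unfolding p_group_def by blast
  define comp where "comp H = {x \<in> V. H \<subseteq> generate G {x}}" for H
  have comp_scc: "comp H \<in> \<Gamma>.sccs_verts" if H: "subgroup H G" "card H = p" for H
  proof -
    obtain h where h: "h \<in> V" "ord h = p" "H = generate G {h}"
      using subgroup_prime_card_generate[OF H p] .
    have to_h: "(x, h) \<in> E" if "x \<in> comp H" for x
      using that h self_in_generate_singleton[of h] by (auto simp: comp_def power_rel_def)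
    have "x \<rightarrow>\<^sup>*\<^bsub>\<Gamma>\<^esub> y" if "x \<in> comp H" "y \<in> comp H" for x y
    proof -
      have "(x, y) \<in> E\<^sup>*"
        using to_h[OF that(1)] power_rel_sym[OF to_h[OF that(2)]] by (meson converse_rtrancl_into_rtrancl r_into_rtrancl)
      then show ?thesis using that(1) by (simp add: reachable_iff comp_def)
    qed
    moreover have "y \<in> comp H" if "x \<in> comp H" "x \<rightarrow>\<^sup>*\<^bsub>\<Gamma>\<^esub> y" for x y
    proof -
      have "h \<in> generate G {x}" using that(1) h self_in_generate_singleton[of h] by (auto simp: comp_def)
      then have hy: "h \<in> generate G {y}"
        using that(2) h(2) p unfolding reachable_iff
        by (intro rtrancl_power_rel_imp_same_prime_subgroup[OF _ _ _ pG, of x y]) auto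
      have "y \<in> V" using \<Gamma>.reachable_in_verts(2)[OF that(2)] by simp
      then show ?thesis using generate_singleton_mono[OF _ hy] h(3) by (simp add: comp_def)
    qed
    moreover have "h \<in> comp H" using h by (simp add: comp_def)
    ultimately show ?thesis unfolding \<Gamma>.sccs_verts_def by blast
  qed
  have "bij_betw comp {H. subgroup H G \<and> card H = p} \<Gamma>.sccs_verts"
  proof (rule bij_betw_imageI)
    show "inj_on comp {H. subgroup H G \<and> card H = p}"
    proof (rule inj_onI)
      fix H K assume H: "H \<in> {H. subgroup H G \<and> card H = p}" and K: "K \<in> {H. subgroup H G \<and> card H = p}"
        and eq: "comp H = comp K"
      obtain h where h: "h \<in> V" "ord h = p" "H = generate G {h}"
        using H subgroup_prime_card_generate[OF _ _ p] by blast
      then have "h \<in> comp K" using eq by (auto simp: comp_def)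
      then have "K \<subseteq> H" using h by (simp add: comp_def)
      moreover have "H \<subseteq> carrier G" using H by (simp add: subgroup.subset)
      then have "finite H" using fin by (rule finite_subset)
      ultimately show "H = K" using H K card_subset_eq[of H K] by simp
    qed
    show "comp ` {H. subgroup H G \<and> card H = p} = \<Gamma>.sccs_verts"
    proof
      show "comp ` {H. subgroup H G \<and> card H = p} \<subseteq> \<Gamma>.sccs_verts" using comp_scc by blast
      show "\<Gamma>.sccs_verts \<subseteq> comp ` {H. subgroup H G \<and> card H = p}"
      proof
        fix S assume S: "S \<in> \<Gamma>.sccs_verts"
        then obtain x where x: "x \<in> S" "x \<rightarrow>\<^sup>*\<^bsub>\<Gamma>\<^esub> x" unfolding \<Gamma>.sccs_verts_def by blast
        then have xV: "x \<in> V" by (simp add: reachable_iff)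
        obtain h where h: "h \<in> generate G {x}" "h \<in> V" "ord h = p"
          using p_group_prime_order_root[OF pG xV] by blast
        have H: "subgroup (generate G {h}) G" "card (generate G {h}) = p"
          using h(2,3) generate_pow_card[of h] by (simp_all add: generate_is_subgroup)
        have "x \<in> comp (generate G {h})"
          using xV generate_singleton_mono[OF _ h(1)] by (simp add: comp_def)
        then have "S = comp (generate G {h})"
          using \<Gamma>.sccs_verts_disjoint[OF S comp_scc[OF H]] x(1) by blast
        with H show "S \<in> comp ` {H. subgroup H G \<and> card H = p}" by blast
      qed
    qed
  qed
  \<comment> \<open>\<open>sccs_verts\<close> holds the vertex sets of the components and has as
    many members as \<open>sccs\<close>.\<close>
  then show ?thesis using bij_betw_same_card \<Gamma>.card_sccs_verts by metis
qed

section \<open>Diameters when several primes divide the order\<close>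

lemma nilpotent_coprime_relpow:
  assumes "nilpotent_group G" "x \<in> V" "y \<in> V" "coprime (ord x) (ord y)"
  shows "(x, y) \<in> E ^^ 2"
proof (rule coprime_commuting_relpow[OF assms(2,3) _ assms(4)])
  show "x \<otimes> y = y \<otimes> x"
    using nilpotent_coprime_orders_commute[OF assms(1) _ _ assms(4)] assms(2,3) by simp
qed

text \<open>If a prime \<open>r\<close> divides both orders, the common subgroup of order
  \<open>r\<close> supplies a vertex below \<open>x\<close> and \<open>y\<close>; if the orders are
  coprime, a product joins them. Elements of two distinct prime orders are not related, so the bound
  2 is attained.\<close>

lemma unique_prime_subgroups_diam:
  assumes nil: "nilpotent_group G" and not_p: "\<nexists>p. p_group p G"
    and uniq: "\<And>p u v. prime p \<Longrightarrow> u \<in> carrier G \<Longrightarrow> v \<in> carrier G \<Longrightarrow> ord u = p \<Longrightarrow> ord v = p \<Longrightarrow>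
      u \<in> generate G {v}"
  shows "graph_connected \<Gamma>" and "graph_diam \<Gamma> = 2"
proof -
  obtain p q where pq: "prime p" "prime q" "p \<noteq> q" "p dvd order G" "q dvd order G"
    using not_p_group_two_primes[OF fin not_p] .
  obtain u where u: "u \<in> carrier G" "ord u = p" using prime_order_element[OF fin pq(1,4)] .
  obtain v where v: "v \<in> carrier G" "ord v = q" using prime_order_element[OF fin pq(2,5)] .
  have dist: "(x, y) \<in> E ^^ Suc 1" if x: "x \<in> V" and y: "y \<in> V" for x y
  proof (cases "coprime (ord x) (ord y)")
    case True
    then show ?thesis using nilpotent_coprime_relpow[OF nil x y] by (simp add: numeral_2_eq_2)
  next
    case False
    then have "gcd (ord x) (ord y) \<noteq> 1" by (simp add: coprime_iff_gcd_eq_1)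
    then obtain r where "prime r" "r dvd gcd (ord x) (ord y)" using prime_factor_nat by blast
    then have r: "prime r" "r dvd ord x" "r dvd ord y" by simp_all
    obtain h where h: "h \<in> generate G {x}" "h \<in> carrier G" "ord h = r" using prime_order_root[OF _ r(2,1)] x by blast
    obtain k where k: "k \<in> generate G {y}" "k \<in> carrier G" "ord k = r" using prime_order_root[OF _ r(3,1)] y by blast
    have "h \<in> generate G {k}" using uniq r(1) h k by blast
    then have "h \<in> generate G {y}" using generate_singleton_mono[OF _ k(1)] y by blast
    then have "(x, h) \<in> E" "(y, h) \<in> E" using h r(1) x y by (simp_all add: power_rel_to_root)
    then show ?thesis using power_rel_sym by auto
  qed
  have "(u, v) \<notin> E"
  proof
    assume "(u, v) \<in> E"
    then have "ord u dvd ord v \<or> ord v dvd ord u"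
      using ord_dvd_ord_generator u(1) v(1) unfolding power_rel_def by blast
    then show False using pq primes_dvd_imp_eq u(2) v(2) by metis
  qed
  then have uv: "(u, v) \<notin> E ^^ 1" by simp
  have "u \<in> V" "v \<in> V" using u v pq prime_order_nontrivial by simp_all
  from graph_diam_eqI[OF dist this uv] show "graph_connected \<Gamma>" "graph_diam \<Gamma> = 2" by simp_all
qed

text \<open>If distinct primes divide \<open>ord x\<close> and \<open>ord y\<close>, the path
  descends to elements of these prime orders, which are joined in two steps: 1 + 2 + 1. Otherwise
  both orders have the same single prime divisor, and an element of another prime order is within
  two steps of each: 2 + 2. A path of length 3 from \<open>u\<close> to \<open>v\<close> would put
  both into one cyclic subgroup.\<close>

lemma two_prime_subgroups_diam:
  assumes nil: "nilpotent_group G" and not_p: "\<nexists>p. p_group p G"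
    and r: "prime r" and u: "u \<in> carrier G" "ord u = r" and v: "v \<in> carrier G" "ord v = r"
    and uv: "u \<notin> generate G {v}"
  shows "graph_connected \<Gamma>" and "graph_diam \<Gamma> = 4"
proof -
  have dist: "(x, y) \<in> E ^^ Suc 3" if x: "x \<in> V" and y: "y \<in> V" for x y
  proof (cases "\<exists>p q. prime p \<and> prime q \<and> p \<noteq> q \<and> p dvd ord x \<and> q dvd ord y")
    case True
    then obtain p q where pq: "prime p" "prime q" "p \<noteq> q" "p dvd ord x" "q dvd ord y" by blast
    obtain h where h: "h \<in> generate G {x}" "h \<in> carrier G" "ord h = p" using prime_order_root[OF _ pq(4,1)] x by blast
    obtain k where k: "k \<in> generate G {y}" "k \<in> carrier G" "ord k = q" using prime_order_root[OF _ pq(5,2)] y by blast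
    have "(h, k) \<in> E ^^ 2"
      using h k pq by (intro nilpotent_coprime_relpow[OF nil] prime_order_nontrivial) (simp_all add: primes_coprime)
    moreover have "(x, h) \<in> E" "(k, y) \<in> E" using h k pq x y power_rel_sym by (simp_all add: power_rel_to_root)
    ultimately have "(x, y) \<in> E ^^ Suc (Suc 2)" by (meson relpow_Suc_I relpow_Suc_I2)
    then show ?thesis by (simp add: numeral_3_eq_3 numeral_2_eq_2)
  next
    case False
    obtain p where p: "prime p" "p dvd ord x" using exists_prime_dvd_ord[OF x] by blast
    obtain p' where p': "prime p'" "p' dvd ord y" using exists_prime_dvd_ord[OF y] by blast
    obtain q where q: "prime q" "q dvd order G" "q \<noteq> p"
      using not_p_group_two_primes[OF fin not_p] by metis
    obtain z where z: "z \<in> carrier G" "ord z = q" using prime_order_element[OF fin q(1,2)] .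
    have "p = p'" using False p p' by blast
    then have "\<not> q dvd ord x" "\<not> q dvd ord y" using False p p' q by blast+
    then have "coprime (ord x) (ord z)" "coprime (ord z) (ord y)"
      using q(1) z(2) by (simp_all add: prime_imp_coprime coprime_commute)
    then have "(x, z) \<in> E ^^ 2" "(z, y) \<in> E ^^ 2"
      using nilpotent_coprime_relpow[OF nil] x y z q(1) prime_order_nontrivial by simp_all
    then have "(x, y) \<in> E ^^ (2 + 2)" unfolding relpow_add by blast
    then show ?thesis by simp
  qed
  \<comment> \<open>If the related vertex \<open>x\<close> is a power of \<open>w\<close>, it
    generates the same group of prime order.\<close>
  have root: "w \<in> generate G {x}" if "(w, x) \<in> E" "w \<in> carrier G" "ord w = r" for w x
    using that generate_eq_of_prime_order[of w x] r by (auto simp: power_rel_def)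
  have not3: "(u, v) \<notin> E ^^ 3"
  proof
    assume "(u, v) \<in> E ^^ 3"
    then obtain a b where ab: "(u, a) \<in> E" "(a, b) \<in> E" "(b, v) \<in> E"
      by (auto simp: numeral_3_eq_3)
    have a: "a \<in> carrier G" and b: "b \<in> carrier G" using ab by (auto simp: power_rel_def)
    have ua: "u \<in> generate G {a}" using root[OF ab(1) u] .
    have vb: "v \<in> generate G {b}" using root[OF power_rel_sym[OF ab(3)] v] .
    \<comment> \<open>The two middle vertices are comparable, so the larger of their cyclic
      subgroups contains both \<open>u\<close> and \<open>v\<close>.\<close>
    from ab(2) consider "a \<in> generate G {b}" | "b \<in> generate G {a}" by (auto simp: power_rel_def)
    then show False
    proof cases
      case 1
      then have "u \<in> generate G {b}" using generate_singleton_mono[OF b] ua by blast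
      then show False using prime_order_cyclic_unique[OF fin b _ u(2) vb v(2) r] uv by blast
    next
      case 2
      then have "v \<in> generate G {a}" using generate_singleton_mono[OF a] vb by blast
      then show False using prime_order_cyclic_unique[OF fin a ua u(2) _ v(2) r] uv by blast
    qed
  qed
  have "u \<in> V" "v \<in> V" using u v r prime_order_nontrivial by simp_all
  from graph_diam_eqI[OF dist this not3] show "graph_connected \<Gamma>" "graph_diam \<Gamma> = 4" by simp_all
qed

end

theorem theorem2p6:
  fixes G :: "('a, 'b) monoid_scheme"
  assumes "nilpotent_group G" and "finite (carrier G)"
  shows
    "(\<forall>p. p_group p G \<longrightarrow>
        card (pre_digraph.sccs (proper_power_graph G)) = card {H. subgroup H G \<and> card H = p} \<and>
        (graph_connected (proper_power_graph G) \<longleftrightarrow>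
           cyclic_group G \<or> generalized_quaternion_2_group G)) \<and>
     ((\<nexists>p. p_group p G) \<and>
      (\<forall>q P. sylow_subgroup q P G \<longrightarrow>
         cyclic_group (G\<lparr>carrier := P\<rparr>) \<or> generalized_quaternion_2_group (G\<lparr>carrier := P\<rparr>)) \<longrightarrow>
        graph_connected (proper_power_graph G) \<and> graph_diam (proper_power_graph G) = 2) \<and>
     ((\<nexists>p. p_group p G) \<and>
      (\<exists>q P. sylow_subgroup q P G \<and>
         \<not> (cyclic_group (G\<lparr>carrier := P\<rparr>) \<or> generalized_quaternion_2_group (G\<lparr>carrier := P\<rparr>))) \<longrightarrow>
        graph_connected (proper_power_graph G) \<and> graph_diam (proper_power_graph G) = 4)"
proof -
  interpret group G using assms(1) unfolding nilpotent_group_def by blast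
  interpret finite_group G by unfold_locales (rule assms(2))
  note sylow_iff = nilpotent_sylow_cyclic_or_quaternion_iff[OF assms]
  show ?thesis
  proof (intro conjI[OF _ conjI] allI impI)
    fix p assume p: "p_group p G"
    show "card (pre_digraph.sccs (proper_power_graph G)) = card {H. subgroup H G \<and> card H = p} \<and>
      (graph_connected (proper_power_graph G) \<longleftrightarrow> cyclic_group G \<or> generalized_quaternion_2_group G)"
      \<comment> \<open>Connectedness and the structural condition reduce to the same criterion on
        elements of order \<open>p\<close>.\<close>
      unfolding p_group_connected_iff[OF p] p_group_cyclic_or_quaternion_iff[OF assms(1) p]
      using p_group_components[OF p] by simp
  next
    assume *: "(\<nexists>p. p_group p G) \<and> (\<forall>q P. sylow_subgroup q P G \<longrightarrow>
      cyclic_group (G\<lparr>carrier := P\<rparr>) \<or> generalized_quaternion_2_group (G\<lparr>carrier := P\<rparr>))"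
    \<comment> \<open>A Sylow subgroup, possibly trivial, exists for every prime \<open>p\<close>,
      so the assumption reaches all elements of prime order.\<close>
    have uniq: "u \<in> generate G {v}"
      if p: "prime p" and uv: "u \<in> carrier G" "v \<in> carrier G" "ord u = p" "ord v = p" for p u v
    proof -
      obtain P where P: "sylow_subgroup p P G" using sylow_subgroup_exists[OF assms(2) p] .
      then show ?thesis using * sylow_iff[OF P] uv by blast
    qed
    show "graph_connected (proper_power_graph G) \<and> graph_diam (proper_power_graph G) = 2"
      using unique_prime_subgroups_diam[OF assms(1) conjunct1[OF *] uniq] by simp
  next
    assume *: "(\<nexists>p. p_group p G) \<and> (\<exists>q P. sylow_subgroup q P G \<and>
      \<not> (cyclic_group (G\<lparr>carrier := P\<rparr>) \<or> generalized_quaternion_2_group (G\<lparr>carrier := P\<rparr>)))"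
    then obtain q P where P: "sylow_subgroup q P G"
      "\<not> (cyclic_group (G\<lparr>carrier := P\<rparr>) \<or> generalized_quaternion_2_group (G\<lparr>carrier := P\<rparr>))"
      by blast
    have q: "prime q" using P(1) unfolding sylow_subgroup_def by blast
    obtain u v where uv: "u \<in> carrier G" "v \<in> carrier G" "ord u = q" "ord v = q" "u \<notin> generate G {v}"
      using P(2) unfolding sylow_iff[OF P(1)] by blast
    show "graph_connected (proper_power_graph G) \<and> graph_diam (proper_power_graph G) = 4"
      using two_prime_subgroups_diam[OF assms(1) conjunct1[OF *] q uv(1,3,2,4,5)] by simp
  qed
qed

end
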